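(* Let $V$ be an $n$-dimensional vector space over a field of characteristic $\neq 2$ with a nondegenerate symplectic form $\xi$, let $(\mathfrak P,\perp)$ be the associated symplectic projective space, and let $k$ be odd with $1\le k\le n-1$. If $k\neq 1$, then $(\mathfrak P,\perp)$ can be defined in terms of the relation $\smile$ on $\mathcal T_k$; if $k\neq n-1$, then $(\mathfrak P,\perp)$ can be defined in terms of the relation $\frown$ on $\mathcal T_k$. Consequently, a bijection of $\mathcal T_k$ which preserves $\smile$ in both directions (when $k\ne 1$), or which preserves $\frown$ in both directions (when $k\neq n-1$), is determined by an automorphism of $(\mathfrak P,\perp)$.
   Context: $V$ is a finite-dimensional vector space over a field of characteristic $\neq 2$, $\xi$ a nondegenerate symplectic (alternating) bilinear form on $V$, $n=\dim V$. $\mathfrak P$ is the projective space of $V$ (points: $1$-dimensional subspaces, lines: $2$-dimensional subspaces); $U_1\perp U_2$ means $\xi(U_1,U_2)=0$; an automorphism of $(\mathfrak P,\perp)$ is a collineation preserving $\perp$ in both directions. For a subspace $U$: $U^\perp=\{u:\xi(u,U)=0\}$, $\mathrm{Rad}(U)=U\cap U^\perp$, $\mathrm{rdim}(U)=\dim\mathrm{Rad}(U)$. $U$ is regular if $\mathrm{rdim}(U)=0$, tangential if $\mathrm{rdim}(U)=1$. $\mathcal{TR}=\{U\le V:\mathrm{rdim}(U)\le 1\}$ and $\mathcal{TR}_j$ its $j$-dimensional members; for odd $k$, $\mathcal{TR}_k=\mathcal T_k$, the set of tangential $k$-subspaces. For $U,W\in\mathcal T_k$: $U\smile W$ means $U\cap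 W\in\mathcal{TR}_{k-1}$ (i.e. $U\cap W$ is a regular $(k-1)$-subspace); $U\frown W$ means $U\neq W$ and $U,W\subset B$ for some $B\in\mathcal{TR}_{k+1}$ (a regular $(k+1)$-subspace). "Can be defined in terms of" means definable (interpretable) from the given structure. *)

theory Defs
  imports Complex_Main
begin

text \<open>
  First-order formulas in the language of one binary relation symbol (with equality), variables
  being indexed by natural numbers, and their truth in a structure with domain \<open>A\<close> and relation
  \<open>E\<close>.
\<close>

datatype fo = Rel nat nat | Eq nat nat | Neg fo | Conj fo fo | Ex nat fo

primrec fo_sat :: "'s set \<Rightarrow> ('s \<Rightarrow> 's \<Rightarrow> bool) \<Rightarrow> (nat \<Rightarrow> 's) \<Rightarrow> fo \<Rightarrow> bool" where
  "fo_sat A E e (Rel i j) \<longleftrightarrow> E (e i) (e j)"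
| "fo_sat A E e (Eq i j) \<longleftrightarrow> e i = e j"
| "fo_sat A E e (Neg \<phi>) \<longleftrightarrow> \<not> fo_sat A E e \<phi>"
| "fo_sat A E e (Conj \<phi> \<psi>) \<longleftrightarrow> fo_sat A E e \<phi> \<and> fo_sat A E e \<psi>"
| "fo_sat A E e (Ex i \<phi>) \<longleftrightarrow> (\<exists>a\<in>A. fo_sat A E (e(i := a)) \<phi>)"

text \<open>
  Definability without parameters of an \<open>m\<close>-ary relation, given as a set \<open>S\<close> of lists; only the
  lists of length \<open>m\<close> over \<open>A\<close> are relevant.  Since the truth of \<open>\<phi>\<close> is required to agree with
  membership in \<open>S\<close> for every assignment, it depends on the variables \<open>0, \<dots>, m - 1\<close> only.
\<close>

definition fo_definable ::
    "'s set \<Rightarrow> ('s \<Rightarrow> 's \<Rightarrow> bool) \<Rightarrow> nat \<Rightarrow> 's list set \<Rightarrow> bool" where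
  "fo_definable A E m S \<longleftrightarrow>
     (\<exists>\<phi>. \<forall>e. range e \<subseteq> A \<longrightarrow> (fo_sat A E e \<phi> \<longleftrightarrow> map e [0..<m] \<in> S))"

text \<open>
  Interpretation of a structure with universe \<open>M\<close> and binary relations \<open>\<R>\<close> in \<open>(A, E)\<close>: the
  elements of \<open>M\<close> are represented, via a coordinate map \<open>h\<close>, by the \<open>m\<close>-tuples in a definable
  set \<open>D\<close>, in such a way that equality and the relations in \<open>\<R>\<close> become definable.  Moreover the
  given relation \<open>I\<close> between elements of \<open>M\<close> and elements of \<open>A\<close> has to become definable.  This
  last clause ties the interpreted copy of \<open>M\<close> to the position of its elements relative to \<open>A\<close>;
  without it, every finite structure would be interpretable in any set with two elements.
\<close>

definition fo_interpretable ::
    "'s set \<Rightarrow> ('s \<Rightarrow> 's \<Rightarrow> bool) \<Rightarrow> 'u set \<Rightarrow> ('u \<Rightarrow> 'u \<Rightarrow> bool) set \<Rightarrow> ('u \<Rightarrow> 's \<Rightarrow> bool) \<Rightarrow> bool" where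
  "fo_interpretable A E M \<R> I \<longleftrightarrow>
     (\<exists>m D h. D \<subseteq> {s. length s = m \<and> set s \<subseteq> A} \<and> h ` D = M \<and>
        fo_definable A E m D \<and>
        (\<forall>R\<in>insert (=) \<R>.
           fo_definable A E (m + m) {s @ t |s t. s \<in> D \<and> t \<in> D \<and> R (h s) (h t)}) \<and>
        fo_definable A E (m + 1) {s @ [a] |s a. s \<in> D \<and> a \<in> A \<and> I (h s) a})"

definition preserves :: "'s set \<Rightarrow> ('s \<Rightarrow> 's \<Rightarrow> bool) \<Rightarrow> ('s \<Rightarrow> 's) \<Rightarrow> bool" where
  "preserves A E f \<longleftrightarrow> (\<forall>U\<in>A. \<forall>W\<in>A. E (f U) (f W) \<longleftrightarrow> E U W)"

locale symplectic_space = finite_dimensional_vector_space scale Basis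
  for scale :: "'k::field \<Rightarrow> 'v::ab_group_add \<Rightarrow> 'v" (infixr \<open>*s\<close> 75) and Basis :: "'v set" +
  fixes \<xi> :: "'v \<Rightarrow> 'v \<Rightarrow> 'k"
  assumes char_neq_2: "CHAR('k) \<noteq> 2"
    and linear_right: "Vector_Spaces.linear scale (*) (\<lambda>w. \<xi> u w)"
    and linear_left: "Vector_Spaces.linear scale (*) (\<lambda>u. \<xi> u w)"
    and alternating: "\<xi> u u = 0"
    and nondegenerate: "(\<And>w. \<xi> u w = 0) \<Longrightarrow> u = 0"
begin

definition points :: "'v set set" where
  "points = {p. subspace p \<and> dim p = 1}"

definition lines :: "'v set set" where
  "lines = {L. subspace L \<and> dim L = 2}"

definition perp :: "'v set \<Rightarrow> 'v set \<Rightarrow> bool" where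
  "perp U W \<longleftrightarrow> (\<forall>u\<in>U. \<forall>w\<in>W. \<xi> u w = 0)"

definition orth :: "'v set \<Rightarrow> 'v set" where
  "orth U = {u. \<forall>w\<in>U. \<xi> u w = 0}"

definition Rad :: "'v set \<Rightarrow> 'v set" where
  "Rad U = U \<inter> orth U"

definition rdim :: "'v set \<Rightarrow> nat" where
  "rdim U = dim (Rad U)"

definition TR :: "nat \<Rightarrow> 'v set set" where
  "TR j = {U. subspace U \<and> dim U = j \<and> rdim U \<le> 1}"

definition tangential :: "nat \<Rightarrow> 'v set set" where
  "tangential k = {U. subspace U \<and> dim U = k \<and> rdim U = 1}"

definition smile :: "nat \<Rightarrow> 'v set \<Rightarrow> 'v set \<Rightarrow> bool" where
  "smile k U W \<longleftrightarrow> U \<in> tangential k \<and> W \<in> tangential k \<and> U \<inter> W \<in> TR (k - 1)"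

definition frown :: "nat \<Rightarrow> 'v set \<Rightarrow> 'v set \<Rightarrow> bool" where
  "frown k U W \<longleftrightarrow> U \<in> tangential k \<and> W \<in> tangential k \<and>
     U \<noteq> W \<and> (\<exists>B\<in>TR (k + 1). U \<subseteq> B \<and> W \<subseteq> B)"

definition points_on :: "'v set \<Rightarrow> 'v set set" where
  "points_on U = {p \<in> points. p \<subseteq> U}"

text \<open>
  A collineation is a bijection of the points under which the point sets of lines are mapped
  onto the point sets of lines, in both directions.
\<close>

definition collineation :: "('v set \<Rightarrow> 'v set) \<Rightarrow> bool" where
  "collineation F \<longleftrightarrow> bij_betw F points points \<and>
     (\<lambda>L. F ` points_on L) ` lines = points_on ` lines"

definition perp_automorphism :: "('v set \<Rightarrow> 'v set) \<Rightarrow> bool" where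
  "perp_automorphism F \<longleftrightarrow> collineation F \<and>
     (\<forall>p\<in>points. \<forall>q\<in>points. perp (F p) (F q) \<longleftrightarrow> perp p q)"

text \<open>
  The two-sorted structure of points and lines with incidence and \<open>\<perp>\<close> is taken with the single
  universe \<open>points \<union> lines\<close>; the points are those elements which are incident with something,
  so the two sorts need no predicates of their own.  The elements of \<open>A\<close> are subspaces, to which
  points and lines are related by inclusion.
\<close>

definition projective_space_definable_from ::
    "'v set set \<Rightarrow> ('v set \<Rightarrow> 'v set \<Rightarrow> bool) \<Rightarrow> bool" where
  "projective_space_definable_from A E \<longleftrightarrow>
     fo_interpretable A E (points \<union> lines)
       {\<lambda>X Y. X \<in> points \<and> Y \<in> lines \<and> X \<subseteq> Y, \<lambda>X Y. X \<in> points \<and> Y \<in> points \<and> perp X Y}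
       (\<subseteq>)"

definition determined_by_automorphism ::
    "'v set set \<Rightarrow> ('v set \<Rightarrow> 'v set) \<Rightarrow> bool" where
  "determined_by_automorphism A f \<longleftrightarrow>
     (\<exists>F. perp_automorphism F \<and> (\<forall>U\<in>A. points_on (f U) = F ` points_on U))"

end

end

theory Submission
  imports Defs
begin

text \<open>
  A point \<open>p\<close> is encoded by any tangential \<open>U\<close> with radical \<open>p\<close>, so everything follows once
  \<open>Rad U \<perp> Rad W\<close> and \<open>Rad U \<subseteq> W\<close> are definable on \<open>\<T>\<^sub>k\<close>.  The map \<open>U \<mapsto> U\<^sup>\<perp>\<close> exchanges \<open>\<frown>\<close> on
  \<open>\<T>\<^sub>k\<close> with \<open>\<smile>\<close> on \<open>\<T>\<^bsub>n-k\<^esub>\<close> and keeps radicals, so only \<open>\<smile>\<close> with \<open>k \<ge> 3\<close> matters.  For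
  \<open>k = n - 1\<close> it is just nonorthogonality of the radicals.

  Let \<open>3 \<le> k \<le> n - 3\<close> and \<open>U \<smile> W\<close>, \<open>B = U + W\<close>.  A common neighbour \<open>X\<close> lies in \<open>B\<close> iff the
  common neighbours of \<open>U, W, X\<close> do not form a clique.  If \<open>Rad U\<close> and \<open>Rad W\<close> are not
  orthogonal, then \<open>B\<close> is regular, and the tangential hyperplanes of \<open>B\<close> correspond to its points,
  with \<open>\<smile>\<close> being nonorthogonality; otherwise \<open>B\<close> has a line as its radical, and
  \<open>\<smile>\<close> between tangential hyperplanes of \<open>B\<close> means having different radicals.  Only in the second case
  is the negation of \<open>\<smile>\<close> transitive on the common neighbours inside \<open>B\<close>, which makes
  orthogonality of the radicals definable for neighbours.  The second case also yields pairs with equal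
  radicals; chains of boundedly many such steps connect any two members of \<open>\<T>\<^sub>k\<close> with the same
  radical.  As any two distinct points are the radicals of some \<open>U \<smile> W\<close>, orthogonality of radicals
  becomes definable in general.
\<close>

section \<open>Dimension counting with hyperplanes, points and lines\<close>

context finite_dimensional_vector_space
begin

lemma span_of_subspace: "subspace S \<Longrightarrow> span S = S"
  by simp

lemma span_insert_hyperplane:
  assumes "subspace X" "subspace B" "X \<subseteq> B" "dim B \<le> dim X + 1" "v \<in> B" "v \<notin> X"
  shows "span (insert v X) = B"
proof -
  have "dim (insert v X) = dim X + 1"
    using assms by (simp add: dim_insert span_of_subspace)
  then have "dim B \<le> dim (span (insert v X))" using assms by simp
  moreover have "span (insert v X) \<subseteq> B" using assms by (intro span_minimal) auto
  ultimately show ?thesis using subspace_dim_equal[OF _ assms(2)] by blast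
qed

text \<open>If some \<open>a\<close> in \<open>A\<close> lies outside \<open>X\<close>, then
  \<open>insert a X\<close> spans \<open>B\<close>. So every vector of \<open>A\<close> is a
  multiple of \<open>a\<close> plus a vector of \<open>A \<inter> X\<close>.\<close>

lemma dim_le_dim_Int_hyperplane:
  assumes "subspace X" "subspace B" "X \<subseteq> B" "dim B \<le> dim X + 1" "subspace A" "A \<subseteq> B"
  shows "dim A \<le> dim (A \<inter> X) + 1"
proof (cases "A \<subseteq> X")
  case True
  then show ?thesis by (simp add: Int_absorb2)
next
  case False
  then obtain a where a: "a \<in> A" "a \<notin> X" by auto
  have B: "span (insert a X) = B" using assms a by (intro span_insert_hyperplane) auto
  have "A \<subseteq> span (insert a (A \<inter> X))"
  proof
    fix y assume y: "y \<in> A"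
    with B assms obtain c where "y - c *s a \<in> X"
      using span_breakdown_eq[of y a X] by (auto simp: span_of_subspace)
    moreover have "y - c *s a \<in> A" using y a assms by (simp add: subspace_diff subspace_scale)
    ultimately show "y \<in> span (insert a (A \<inter> X))"
      unfolding span_breakdown_eq by (auto intro: span_base)
  qed
  then have "dim A \<le> dim (insert a (A \<inter> X))" by (rule dim_mono)
  also have "\<dots> \<le> dim (A \<inter> X) + 1" by (simp add: dim_insert)
  finally show ?thesis .
qed

text \<open>As for groups: if neither of the vectors \<open>x\<close>, \<open>y\<close> witnessing
  the two non-inclusions avoids both subspaces, then \<open>x + y\<close> does.\<close>

lemma subspace_not_covered_by_two:
  assumes "subspace D" "subspace X" "subspace Y" "\<not> D \<subseteq> X" "\<not> D \<subseteq> Y"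
  obtains v where "v \<in> D" "v \<notin> X" "v \<notin> Y"
proof -
  from assms obtain x y where x: "x \<in> D" "x \<notin> X" and y: "y \<in> D" "y \<notin> Y" by auto
  consider "x \<notin> Y" | "y \<notin> X" | "x \<in> Y" "y \<in> X" by auto
  then show thesis
  proof cases
    case 3
    have "x + y \<in> D" using x y assms by (simp add: subspace_add)
    moreover have "x + y \<notin> X"
      using subspace_diff[of X "x + y" y] 3 x assms by auto
    moreover have "x + y \<notin> Y"
      using subspace_diff[of Y "x + y" x] 3 y assms by auto
    ultimately show thesis by (rule that)
  qed (use x y that in auto)
qed

lemma dim_eq_1_E:
  assumes "subspace P" "dim P = 1"
  obtains p where "p \<noteq> 0" "P = span {p}"
proof -
  have "\<not> P \<subseteq> {0}" using assms(2) dim_eq_0[of P] by linarith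
  then obtain p where p: "p \<in> P" "p \<noteq> 0" by auto
  have "span {p} \<subseteq> P" using p assms by (intro span_minimal) auto
  then have "span {p} = P" using p assms by (intro subspace_dim_equal) auto
  with p that show thesis by auto
qed

lemma span_singleton_eqI: "u \<in> span {p} \<Longrightarrow> u \<noteq> 0 \<Longrightarrow> span {u} = span {p}"
  using span_minimal[of "{u}" "span {p}"]
  by (intro subspace_dim_equal) (auto simp: dim_span[of "{u}"] dim_span[of "{p}"] simp del: span_eq_iff)

lemma dim_span_2_E:
  assumes "subspace L" "dim L = 2"
  obtains p q where "p \<noteq> 0" "q \<noteq> 0" "span {p} \<noteq> span {q}" "L = span {p, q}"
proof -
  have "\<not> L \<subseteq> {0}" using assms(2) dim_eq_0[of L] by linarith
  then obtain p where p: "p \<in> L" "p \<noteq> 0" by auto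
  have "\<not> L \<subseteq> span {p}" using dim_mono[of L "{p}"] assms(2) p by auto
  then obtain q where q: "q \<in> L" "q \<notin> span {p}" by auto
  have "dim {q, p} = 2" using p q by (simp add: dim_insert)
  moreover have "span {q, p} \<subseteq> L" using p q assms by (intro span_minimal) auto
  ultimately have "span {q, p} = L" using assms by (intro subspace_dim_equal) auto
  moreover have "span {p} \<noteq> span {q}" using q span_base[of q "{q}"] by auto
  moreover have "q \<noteq> 0" using q by (auto simp: span_zero)
  ultimately show thesis using that p by (metis insert_commute)
qed

end

context symplectic_space
begin

subsection \<open>Orthogonal complements and regular subspaces\<close>

lemma form_add_left: "\<xi> (u + v) w = \<xi> u w + \<xi> v w"
  using linear_left[of w] by (simp add: Vector_Spaces.linear_iff)

lemma form_add_right: "\<xi> w (u + v) = \<xi> w u + \<xi> w v"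
  using linear_right[of w] by (simp add: Vector_Spaces.linear_iff)

lemma form_scale_left: "\<xi> (c *s u) w = c * \<xi> u w"
  using linear_left[of w] by (simp add: Vector_Spaces.linear_iff)

lemma form_scale_right: "\<xi> w (c *s u) = c * \<xi> w u"
  using linear_right[of w] by (simp add: Vector_Spaces.linear_iff)

lemma form_skew: "\<xi> u w = - \<xi> w u"
proof -
  have "\<xi> (u + w) (u + w) = \<xi> u w + \<xi> w u"
    by (simp only: form_add_left form_add_right) (simp add: alternating)
  then show ?thesis by (simp add: alternating eq_neg_iff_add_eq_0)
qed

lemma form_eq_0_commute: "\<xi> u w = 0 \<longleftrightarrow> \<xi> w u = 0"
  using form_skew[of u w] by simp

lemma form_0_left [simp]: "\<xi> 0 w = 0"
  using form_scale_left[of 0 0 w] by simp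

lemma form_0_right [simp]: "\<xi> w 0 = 0"
  using form_scale_right[of w 0 0] by simp

lemma form_diff_left: "\<xi> (u - v) w = \<xi> u w - \<xi> v w"
  using form_add_left[of "u - v" v w] by (simp add: algebra_simps)

lemma form_diff_right: "\<xi> w (u - v) = \<xi> w u - \<xi> w v"
  using form_add_right[of w "u - v" v] by (simp add: algebra_simps)

lemmas form_simps = form_add_left form_add_right form_scale_left form_scale_right
  form_diff_left form_diff_right alternating

lemma subspace_orth [simp]: "subspace (orth U)"
  unfolding orth_def by (auto simp: subspace_def form_simps)

lemma orth_span [simp]: "orth (span U) = orth U"
proof
  show "orth (span U) \<subseteq> orth U" unfolding orth_def by (auto intro: span_base)
  show "orth U \<subseteq> orth (span U)"
  proof
    fix u assume u: "u \<in> orth U"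
    have "\<xi> u w = 0" if "w \<in> span U" for w
      proof -
      have "w \<in> {w. \<xi> u w = 0}"
        using that
      proof (rule span_subspace_induct)
        show "subspace {w. \<xi> u w = 0}" by (auto simp: subspace_def form_simps)
        show "w \<in> {w. \<xi> u w = 0}" if "w \<in> U" for w using u that by (auto simp: orth_def)
      qed
      then show ?thesis by simp
    qed
    then show "u \<in> orth (span U)" by (auto simp: orth_def)
  qed
qed

lemma in_orth_span: "u \<in> orth (span U) \<longleftrightarrow> (\<forall>w\<in>U. \<xi> u w = 0)"
  by (subst orth_span) (simp add: orth_def)

lemma orth_insert: "orth (insert a U) = orth {a} \<inter> orth U"
  by (auto simp: orth_def)

lemma orth_Un: "orth (A \<union> B) = orth A \<inter> orth B"
  by (auto simp: orth_def)

lemma orth_antimono: "A \<subseteq> B \<Longrightarrow> orth B \<subseteq> orth A"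
  by (auto simp: orth_def)

lemma in_orth_singleton: "u \<in> orth {a} \<longleftrightarrow> \<xi> u a = 0"
  by (auto simp: orth_def)

lemma subset_orth_commute: "A \<subseteq> orth B \<longleftrightarrow> B \<subseteq> orth A"
  using form_eq_0_commute by (auto simp: orth_def)

lemma perp_iff: "perp U W \<longleftrightarrow> U \<subseteq> orth W"
  by (auto simp: perp_def orth_def)

lemma perp_span: "perp (span {p}) (span {q}) \<longleftrightarrow> \<xi> p q = 0"
proof -
  have "perp (span {p}) (span {q}) \<longleftrightarrow> {p} \<subseteq> orth (span {q})"
    unfolding perp_iff by (metis span_minimal span_superset subset_trans subspace_orth)
  then show ?thesis by (simp add: in_orth_singleton)
qed

text \<open>A single vector of \<open>A\<close> that is not orthogonal to \<open>c\<close> suffices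
  to correct every vector of \<open>A\<close> to one orthogonal to \<open>c\<close>.\<close>

lemma dim_Int_orth_singleton_ge:
  assumes "subspace A"
  shows "dim A \<le> dim (A \<inter> orth {c}) + 1"
proof (cases "A \<subseteq> orth {c}")
  case True
  then show ?thesis by (simp add: Int_absorb2)
next
  case False
  then obtain a where a: "a \<in> A" "\<xi> a c \<noteq> 0" using in_orth_singleton by blast
  have "A \<subseteq> span (insert a (A \<inter> orth {c}))"
  proof
    fix y assume y: "y \<in> A"
    let ?z = "y - (\<xi> y c / \<xi> a c) *s a"
    have "?z \<in> A" using y a assms by (simp add: subspace_diff subspace_scale)
    moreover have "\<xi> ?z c = 0" using a by (simp add: form_simps)
    ultimately have "?z \<in> span (A \<inter> orth {c})" by (intro span_base) (simp add: in_orth_singleton)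
    then show "y \<in> span (insert a (A \<inter> orth {c}))"
      unfolding span_breakdown_eq by blast
  qed
  then have "dim A \<le> dim (insert a (A \<inter> orth {c}))" by (rule dim_mono)
  also have "\<dots> \<le> dim (A \<inter> orth {c}) + 1" by (simp add: dim_insert)
  finally show ?thesis .
qed

lemma dim_Int_orth_singleton:
  assumes "subspace A" "a \<in> A" "\<xi> a c \<noteq> 0"
  shows "dim (A \<inter> orth {c}) + 1 = dim A"
proof -
  have "dim (insert a (A \<inter> orth {c})) = dim (A \<inter> orth {c}) + 1"
    using assms by (simp add: dim_insert in_orth_singleton span_of_subspace subspace_inter)
  moreover have "dim (insert a (A \<inter> orth {c})) \<le> dim A" using assms by (intro dim_subset) auto
  ultimately show ?thesis using dim_Int_orth_singleton_ge[OF assms(1), of c] by simp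
qed

lemma dim_Int_orth_finite_ge:
  assumes "finite T" "subspace A"
  shows "dim A \<le> dim (A \<inter> orth T) + card T"
  using assms
proof (induction T)
  case empty
  then show ?case by (simp add: orth_def)
next
  case (insert c T)
  have "dim (A \<inter> orth T) \<le> dim ((A \<inter> orth T) \<inter> orth {c}) + 1"
    using insert.prems by (intro dim_Int_orth_singleton_ge) (simp add: subspace_inter)
  moreover have "(A \<inter> orth T) \<inter> orth {c} = A \<inter> orth (insert c T)"
    using orth_insert[of c T] by auto
  ultimately show ?case using insert by simp
qed

text \<open>Both sides, minus the two intersections, are the rank of the pairing between \<open>A\<close> and \<open>S\<close>.\<close>

lemma dim_Int_orth:
  assumes "subspace A" "subspace S"
  shows "dim A + dim (S \<inter> orth A) = dim S + dim (A \<inter> orth S)"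
proof -
  have *: "dim A + dim (S \<inter> orth A) \<le> dim S + dim (A \<inter> orth S)"
    if A: "subspace A" and S: "subspace S" for A S
  proof -
    \<comment> \<open>A basis \<open>B1\<close> of \<open>S \<inter> orth A\<close> is extended to a
      basis \<open>B\<close> of \<open>S\<close>. The vectors of \<open>B1\<close> impose no
      condition on vectors of \<open>A\<close>, so only \<open>card (B - B1)\<close> conditions lead
      from \<open>A\<close> to \<open>A \<inter> orth S\<close>.\<close>
    obtain B1 where B1: "B1 \<subseteq> S \<inter> orth A" "independent B1" "S \<inter> orth A \<subseteq> span B1"
      "card B1 = dim (S \<inter> orth A)" by (rule basis_exists)
    obtain B where B: "B1 \<subseteq> B" "B \<subseteq> S" "independent B" "S \<subseteq> span B"
      using maximal_independent_subset_extend[of B1 S] B1 by blast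
    have fin: "finite B" using B finiteI_independent by blast
    have "A \<inter> orth (B - B1) \<subseteq> A \<inter> orth S"
    proof
      fix x assume x: "x \<in> A \<inter> orth (B - B1)"
      have "x \<in> orth B1" using B1(1) x subset_orth_commute[of B1 A] by auto
      then have "x \<in> orth (B1 \<union> (B - B1))" using x by (simp only: orth_Un) blast
      then have "x \<in> orth (span B)" using B(1) by (simp add: Un_absorb1)
      then show "x \<in> A \<inter> orth S" using x B(4) orth_antimono by blast
    qed
    then have "dim (A \<inter> orth (B - B1)) \<le> dim (A \<inter> orth S)" by (rule dim_subset)
    moreover have "dim A \<le> dim (A \<inter> orth (B - B1)) + card (B - B1)"
      using fin A by (intro dim_Int_orth_finite_ge) auto
    moreover have "card (B - B1) + card B1 = dim S"
      using B fin basis_card_eq_dim[of B S] card_mono[of B B1]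
      by (simp add: card_Diff_subset finite_subset)
    ultimately show ?thesis using B1(4) by simp
  qed
  show ?thesis using *[OF assms] *[OF assms(2,1)] by simp
qed

lemma orth_UNIV: "orth UNIV = {0}"
  using nondegenerate by (auto simp: orth_def)

lemma dim_orth:
  assumes "subspace U"
  shows "dim U + dim (orth U) = dim (UNIV :: 'v set)"
proof -
  show ?thesis
    using dim_Int_orth[of UNIV U] assms by (simp add: orth_UNIV subspace_0 del: dim_UNIV)
qed

lemma orth_orth:
  assumes "subspace U"
  shows "orth (orth U) = U"
proof -
  have "U \<subseteq> orth (orth U)" using subset_orth_commute[of U "orth U"] by simp
  moreover have "dim (orth (orth U)) = dim U"
    using dim_orth[OF assms] dim_orth[of "orth U"] by simp
  ultimately show ?thesis using subspace_dim_equal[of U "orth (orth U)"] assms by simp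
qed

lemma orth_subset_iff: "subspace U \<Longrightarrow> subspace W \<Longrightarrow> orth U \<subseteq> orth W \<longleftrightarrow> W \<subseteq> U"
  by (metis orth_antimono orth_orth)

lemma subspace_Rad [simp]: "subspace U \<Longrightarrow> subspace (Rad U)"
  by (simp add: Rad_def subspace_inter)

lemma Rad_subset: "Rad U \<subseteq> U"
  by (simp add: Rad_def)

section \<open>Regular subspaces and the parity of dimensions\<close>

definition regular :: "'v set \<Rightarrow> bool" where
  "regular M \<longleftrightarrow> subspace M \<and> Rad M = {0}"

lemma regular_subspace: "regular M \<Longrightarrow> subspace M"
  by (simp add: regular_def)

lemma regularI:
  assumes "subspace M" "\<And>v. v \<in> M \<Longrightarrow> v \<in> orth M \<Longrightarrow> v = 0"
  shows "regular M"
  using assms by (auto simp: regular_def Rad_def subspace_0)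

lemma regularD: "regular M \<Longrightarrow> v \<in> M \<Longrightarrow> v \<in> orth M \<Longrightarrow> v = 0"
  by (auto simp: regular_def Rad_def)

lemma regular_iff_rdim: "subspace M \<Longrightarrow> regular M \<longleftrightarrow> rdim M = 0"
  by (auto simp: regular_def rdim_def subspace_0)

lemma regular_UNIV: "regular UNIV"
  by (simp add: regular_def Rad_def orth_UNIV)

lemma dim_regular_Int_orth:
  assumes "regular M" "subspace C" "M \<subseteq> C"
  shows "dim (C \<inter> orth M) + dim M = dim C"
proof -
  have "M \<inter> orth C \<subseteq> {0}"
    using regularD[OF assms(1)] orth_antimono[OF assms(3)] by auto
  then have "dim (M \<inter> orth C) = 0" by simp
  then show ?thesis using dim_Int_orth[OF assms(2) regular_subspace[OF assms(1)]] by linarith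
qed

text \<open>Orthogonal splitting of \<open>C\<close> along \<open>M\<close>. Counting dimensions in
  \<open>span (insert v M)\<close> gives a nonzero \<open>b\<close> orthogonal to \<open>M\<close>.
  Its coefficient at \<open>v\<close> is nonzero because \<open>M\<close> is regular, so
  \<open>v\<close> can be solved for.\<close>

lemma regular_decompose:
  assumes "regular M" "subspace C" "M \<subseteq> C" "v \<in> C"
  obtains a b where "a \<in> M" "b \<in> C \<inter> orth M" "v = a + b"
proof -
  have M: "subspace M" using assms regular_subspace by blast
  let ?S = "span (insert v M)"
  have sS: "subspace ?S" by simp
  have MS: "M \<subseteq> ?S" by (auto intro: span_base)
  show thesis
  proof (cases "v \<in> M")
    case True
    then show thesis using that[of v 0] assms by (auto simp: subspace_0 subspace_inter)
  next
    case False
    then have "dim ?S = dim M + 1" using M by (simp add: dim_insert span_of_subspace)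
    then have "dim (?S \<inter> orth M) = 1" using dim_regular_Int_orth[OF assms(1) sS MS] by simp
    then obtain b where b: "b \<noteq> 0" "?S \<inter> orth M = span {b}"
      using dim_eq_1_E[of "?S \<inter> orth M"] sS by (auto simp: subspace_inter)
    then have bS: "b \<in> ?S" "b \<in> orth M" by (auto intro: span_base)
    then obtain c where c: "b - c *s v \<in> M" using M by (auto simp: span_breakdown_eq span_of_subspace)
    have c0: "c \<noteq> 0" using c bS b regularD[OF assms(1)] by auto
    have "?S \<subseteq> C" using assms by (intro span_minimal) auto
    then have "(1 / c) *s b \<in> C \<inter> orth M" using bS assms by (auto simp: subspace_scale)
    moreover have "- ((1 / c) *s (b - c *s v)) \<in> M" using c M by (simp add: subspace_scale subspace_neg)
    moreover have "v = - ((1 / c) *s (b - c *s v)) + (1 / c) *s b"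
      using c0 by (simp add: scale_right_diff_distrib)
    ultimately show thesis using that by blast
  qed
qed


text \<open>A vector of \<open>C \<inter> orth M\<close> is already orthogonal to \<open>M\<close>.
  If it is also orthogonal to \<open>C \<inter> orth M\<close>, the splitting makes it orthogonal to
  all of \<open>C\<close>.\<close>

lemma Rad_Int_orth_regular_subset:
  assumes "regular M" "subspace C" "M \<subseteq> C"
  shows "Rad (C \<inter> orth M) \<subseteq> Rad C"
proof
  fix v assume v: "v \<in> Rad (C \<inter> orth M)"
  have "\<xi> v c = 0" if c: "c \<in> C" for c
  proof -
    obtain a b where "a \<in> M" "b \<in> C \<inter> orth M" "c = a + b"
      using regular_decompose[OF assms c] .
    with v show ?thesis by (auto simp: Rad_def orth_def form_simps)
  qed
  with v show "v \<in> Rad C" by (auto simp: Rad_def orth_def)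
qed

text \<open>A hyperbolic plane orthogonal to \<open>M\<close> is added. Pairing a radical vector
  with \<open>w\<close> and with \<open>u\<close> kills its coefficients at \<open>u\<close> and
  \<open>w\<close>, which leaves an element of \<open>M \<inter> orth M\<close>.\<close>

lemma regular_insert_insert:
  assumes "regular M" "u \<in> orth M" "w \<in> orth M" "\<xi> u w \<noteq> 0"
  shows "regular (span (insert u (insert w M)))" "dim (span (insert u (insert w M))) = dim M + 2"
proof -
  have M: "subspace M" using assms regular_subspace by blast
  have wu: "\<xi> w u \<noteq> 0" using assms form_eq_0_commute by blast
  have w: "w \<notin> M" using regularD[OF assms(1), of w] assms by auto
  have u: "u \<notin> span (insert w M)"
  proof
    assume "u \<in> span (insert w M)"
    then obtain c where c: "u - c *s w \<in> M" using M by (auto simp: span_breakdown_eq span_of_subspace)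
    have "u - c *s w \<in> orth M" using assms by (simp add: subspace_diff subspace_scale)
    then have "u = c *s w" using regularD[OF assms(1) c] by simp
    then show False using assms by (simp add: form_simps)
  qed
  show "dim (span (insert u (insert w M))) = dim M + 2"
    using u w M by (simp add: dim_insert span_of_subspace)
  show "regular (span (insert u (insert w M)))"
  proof (rule regularI)
    fix v assume v: "v \<in> span (insert u (insert w M))" "v \<in> orth (span (insert u (insert w M)))"
    then obtain a b where ab: "v - a *s u - b *s w \<in> M" using M by (auto simp: span_breakdown_eq span_of_subspace)
    define m where "m = v - a *s u - b *s w"
    have m: "m \<in> M" "v = m + a *s u + b *s w" using ab by (auto simp: m_def)
    have mu: "\<xi> m u = 0" "\<xi> m w = 0" using m(1) assms form_eq_0_commute by (auto simp: orth_def)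
    have "\<xi> v u = 0" "\<xi> v w = 0" "v \<in> orth M" using v(2) unfolding in_orth_span by (auto simp: orth_def)
    then have vm: "v = m" using mu m(2) assms wu by (simp add: form_simps)
    then show "v = 0" using regularD[OF assms(1) m(1)] \<open>v \<in> orth M\<close> by simp
  qed simp
qed

text \<open>Hyperbolic planes are split off one at a time. This could only fail if
  \<open>C \<inter> orth M\<close> were totally isotropic and hence contained in
  \<open>Rad C\<close>, for which its dimension is too large.\<close>

lemma exists_regular_subspace:
  assumes "subspace C" "2 * j + rdim C \<le> dim C"
  shows "\<exists>M. regular M \<and> M \<subseteq> C \<and> dim M = 2 * j"
  using assms(2)
proof (induction j)
  case 0
  have "regular {0}" by (intro regularI) auto
  then show ?case using subspace_0[OF assms(1)] by (intro exI[of _ "{0}"]) auto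
next
  case (Suc j)
  then obtain M where M: "regular M" "M \<subseteq> C" "dim M = 2 * j" by auto
  let ?C = "C \<inter> orth M"
  have "\<not> ?C \<subseteq> orth ?C"
  proof
    assume "?C \<subseteq> orth ?C"
    then have "?C \<subseteq> Rad C" using Rad_Int_orth_regular_subset[OF M(1) assms(1) M(2)] by (auto simp: Rad_def)
    then have "dim ?C \<le> rdim C" unfolding rdim_def by (rule dim_subset)
    then show False using dim_regular_Int_orth[OF M(1) assms(1) M(2)] M(3) Suc.prems by simp
  qed
  then obtain u w where uw: "u \<in> ?C" "w \<in> ?C" "\<xi> u w \<noteq> 0" by (auto simp: orth_def)
  have "span (insert u (insert w M)) \<subseteq> C" using uw M(2) assms(1) by (intro span_minimal) auto
  then show ?case using regular_insert_insert[OF M(1), of u w] uw M(3) by auto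
qed

text \<open>If the parities differed, a regular \<open>M\<close> of dimension
  \<open>dim C - rdim C - 1\<close> would leave in \<open>C \<inter> orth M\<close> just one vector
  \<open>v\<close> besides \<open>Rad C\<close>. Since \<open>\<xi>\<close> is alternating,
  \<open>v\<close> is orthogonal to itself, so it would belong to the radical after all.\<close>

lemma even_dim_iff_even_rdim:
  assumes "subspace C"
  shows "even (dim C) \<longleftrightarrow> even (rdim C)"
proof (rule ccontr)
  assume *: "(even (dim C)) \<noteq> (even (rdim C))"
  have le: "rdim C \<le> dim C" unfolding rdim_def by (rule dim_subset[OF Rad_subset])
  define j where "j = (dim C - rdim C) div 2"
  have j: "2 * j + rdim C + 1 = dim C" using * le odd_two_times_div_two_succ[of "dim C - rdim C"] unfolding j_def by fastforce
  then obtain M where M: "regular M" "M \<subseteq> C" "dim M = 2 * j"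
    using exists_regular_subspace[OF assms, of j] by auto
  let ?C = "C \<inter> orth M"
  have d: "dim ?C = rdim C + 1" using dim_regular_Int_orth[OF M(1) assms M(2)] M(3) j by simp
  have sub: "Rad C \<subseteq> ?C" using orth_antimono[OF M(2)] by (auto simp: Rad_def)
  have "\<not> ?C \<subseteq> Rad C" using d dim_subset[of ?C "Rad C"] by (auto simp: rdim_def)
  then obtain v where v: "v \<in> ?C" "v \<notin> Rad C" by auto
  have C: "span (insert v (Rad C)) = ?C"
    using v sub d assms by (intro span_insert_hyperplane) (auto simp: rdim_def subspace_inter)
  have "v \<in> orth (insert v (Rad C))" using v form_eq_0_commute alternating by (auto simp: orth_def Rad_def)
  then have "v \<in> orth ?C" unfolding C[symmetric] by simp
  then have "v \<in> Rad ?C" using v(1) by (simp add: Rad_def)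
  then show False using v(2) Rad_Int_orth_regular_subset[OF M(1) assms M(2)] by auto
qed

subsection \<open>Tangential subspaces inside regular and degenerate subspaces\<close>

text \<open>In even dimension, parity excludes a radical of dimension 1.\<close>

lemma TR_even: "even j \<Longrightarrow> U \<in> TR j \<longleftrightarrow> regular U \<and> dim U = j"
  using even_dim_iff_even_rdim[of U] regular_iff_rdim[of U] regular_subspace[of U]
  by (auto simp: TR_def dest: le_Suc_eq[THEN iffD1])

lemma tangentialD:
  assumes "U \<in> tangential k"
  shows "subspace U" "dim U = k" "dim (Rad U) = 1"
  using assms by (auto simp: tangential_def rdim_def)

lemma tangentialE:
  assumes "U \<in> tangential k"
  obtains p where "p \<noteq> 0" "Rad U = span {p}" "p \<in> U" "p \<in> orth U"
proof -
  obtain p where p: "p \<noteq> 0" "Rad U = span {p}"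
    using dim_eq_1_E[of "Rad U"] tangentialD[OF assms] by auto
  then have "p \<in> Rad U" by (auto intro: span_base)
  then show thesis using that p by (auto simp: Rad_def)
qed

lemma tangentialI:
  assumes "subspace U" "dim U = k" "p \<noteq> 0" "p \<in> U" "p \<in> orth U"
    and "\<And>v. v \<in> U \<Longrightarrow> v \<in> orth U \<Longrightarrow> v \<in> span {p}"
  shows "U \<in> tangential k" "Rad U = span {p}"
proof -
  have "span {p} \<subseteq> Rad U" using assms by (intro span_minimal) (auto simp: Rad_def subspace_inter)
  then show R: "Rad U = span {p}" using assms by (auto simp: Rad_def)
  show "U \<in> tangential k" using assms R by (simp add: tangential_def rdim_def)
qed

text \<open>Together with \<open>tangential_eq_insert\<close> this gives a normal form: a tangential
  subspace is the orthogonal sum of a regular hyperplane and its radical point. A radical vector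
  differs from a multiple of \<open>p\<close> by an element of
  \<open>M \<inter> orth M\<close>.\<close>

lemma tangential_insert:
  assumes "regular M" "p \<in> orth M" "p \<noteq> 0"
  shows "span (insert p M) \<in> tangential (dim M + 1)" "Rad (span (insert p M)) = span {p}"
proof -
  have M: "subspace M" using assms regular_subspace by blast
  have p: "p \<notin> M" using regularD[OF assms(1)] assms by auto
  have d: "dim (span (insert p M)) = dim M + 1" using p M by (simp add: dim_insert span_of_subspace)
  have po: "p \<in> orth (span (insert p M))" using assms(2) unfolding in_orth_span by (auto simp: orth_def alternating)
  have v: "v \<in> span {p}" if v: "v \<in> span (insert p M)" "v \<in> orth (span (insert p M))" for v
  proof -
    obtain c where c: "v - c *s p \<in> M" using v M by (auto simp: span_breakdown_eq span_of_subspace)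
    have "v \<in> orth M" using v(2) unfolding in_orth_span by (auto simp: orth_def)
    then have "v - c *s p \<in> orth M" using assms by (simp add: subspace_diff subspace_scale)
    then have "v = c *s p" using regularD[OF assms(1) c] by simp
    then show ?thesis by (auto simp: span_singleton)
  qed
  have pi: "p \<in> span (insert p M)" by (simp add: span_base)
  show "span (insert p M) \<in> tangential (dim M + 1)" "Rad (span (insert p M)) = span {p}"
    using tangentialI[OF subspace_span d assms(3) pi po v] by auto
qed

lemma tangential_eq_insert:
  assumes "regular M" "M \<subseteq> U" "U \<in> tangential (dim M + 1)" "Rad U = span {p}" "p \<noteq> 0"
  shows "U = span (insert p M)" "p \<in> orth M" "p \<in> orth U" "p \<in> U" "p \<notin> M"
proof -
  have "p \<in> Rad U" using assms by (auto intro: span_base)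
  then show p: "p \<in> orth U" "p \<in> U" by (auto simp: Rad_def)
  then show "p \<in> orth M" using assms orth_antimono by blast
  then show "p \<notin> M" using assms regularD by blast
  then show "U = span (insert p M)"
    using tangentialD[OF assms(3)] assms p regular_subspace
    by (intro span_insert_hyperplane[symmetric]) auto
qed

text \<open>As \<open>k - 1\<close> is even, \<open>TR_even\<close> applies to the intersection.
  Since \<open>k\<close> is positive, the dimension condition can be stated without truncated
  subtraction.\<close>

lemma smile_iff:
  assumes "odd k"
  shows "smile k U W \<longleftrightarrow> U \<in> tangential k \<and> W \<in> tangential k \<and> regular (U \<inter> W) \<and> dim (U \<inter> W) + 1 = k"
  using assms odd_pos[OF assms] by (auto simp: smile_def TR_even)

lemma tangential_complement:
  assumes "odd k" "U \<in> tangential k"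
  obtains M where "regular M" "M \<subseteq> U" "dim M + 1 = k"
proof -
  have "2 * ((k - 1) div 2) + rdim U \<le> dim U"
    using assms tangentialD[OF assms(2)] by (auto simp: rdim_def elim: oddE)
  then obtain M where "regular M" "M \<subseteq> U" "dim M = 2 * ((k - 1) div 2)"
    using exists_regular_subspace tangentialD[OF assms(2)] by blast
  then show thesis using that assms(1) odd_pos[OF assms(1)] by (auto elim: oddE)
qed

text \<open>Having different radicals, the two subspaces cannot coincide, so their intersection is
  no larger than the common hyperplane \<open>M\<close>.\<close>

lemma smile_insert:
  assumes "odd k" "regular M" "dim M + 1 = k" "p \<noteq> 0" "q \<noteq> 0" "p \<in> orth M" "q \<in> orth M"
    "span {p} \<noteq> span {q}"
  shows "smile k (span (insert p M)) (span (insert q M))"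
proof -
  let ?U = "span (insert p M)" and ?W = "span (insert q M)"
  have U: "?U \<in> tangential k" "Rad ?U = span {p}"
    using tangential_insert[of M p] assms by auto
  have W: "?W \<in> tangential k" "Rad ?W = span {q}"
    using tangential_insert[of M q] assms by auto
  have M: "subspace M" using assms regular_subspace by blast
  have sub: "M \<subseteq> ?U \<inter> ?W" by (auto intro: span_base)
  have "\<not> k \<le> dim (?U \<inter> ?W)"
  proof
    assume *: "k \<le> dim (?U \<inter> ?W)"
    have "?U \<inter> ?W = ?U"
      by (rule subspace_dim_equal)
        (use * tangentialD[OF U(1)] in \<open>simp_all add: subspace_inter del: dim_span\<close>)
    moreover have "?U \<inter> ?W = ?W"
      by (rule subspace_dim_equal)
        (use * tangentialD[OF W(1)] in \<open>simp_all add: subspace_inter del: dim_span\<close>)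
    ultimately show False using U W assms(8) by auto
  qed
  then have "M = ?U \<inter> ?W" using sub M assms by (intro subspace_dim_equal) (auto simp: subspace_inter)
  then show ?thesis using U W assms by (simp add: smile_iff)
qed

text \<open>A radical vector of the hyperplane, corrected by a multiple of \<open>s\<close>, becomes
  orthogonal to a vector \<open>a\<close> outside the hyperplane too. Then it is orthogonal to all
  of \<open>B\<close> and vanishes.\<close>

lemma regular_hyperplane:
  assumes "regular B" "dim B = k + 1" "s \<in> B" "s \<noteq> 0"
  shows "B \<inter> orth {s} \<in> tangential k" "Rad (B \<inter> orth {s}) = span {s}"
proof -
  have B: "subspace B" using assms regular_subspace by blast
  obtain a where a: "a \<in> B" "\<xi> a s \<noteq> 0"
    using regularD[OF assms(1,3)] assms(4) form_eq_0_commute by (auto simp: orth_def)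
  have d: "dim (B \<inter> orth {s}) = k" using dim_Int_orth_singleton[OF B a] assms by simp
  have span: "span (insert a (B \<inter> orth {s})) = B"
    using a B d assms by (intro span_insert_hyperplane) (auto simp: subspace_inter in_orth_singleton)
  have sa: "\<xi> s a \<noteq> 0" using a form_eq_0_commute by blast
  have v: "v \<in> span {s}" if v: "v \<in> B \<inter> orth {s}" "v \<in> orth (B \<inter> orth {s})" for v
  proof -
    let ?v = "v - (\<xi> v a / \<xi> s a) *s s"
    have "s \<in> orth (B \<inter> orth {s})" using form_eq_0_commute by (auto simp: orth_def)
    then have "?v \<in> orth (insert a (B \<inter> orth {s}))"
      using v sa by (auto simp: orth_insert[of a "B \<inter> orth {s}"] in_orth_singleton form_simps subspace_diff subspace_scale)
    then have "?v \<in> orth B" using span orth_span by metis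
    moreover have "?v \<in> B" using v assms B by (simp add: subspace_diff subspace_scale)
    ultimately have "?v = 0" using regularD[OF assms(1)] by blast
    then show ?thesis by (auto simp: span_singleton)
  qed
  have so: "s \<in> orth (B \<inter> orth {s})" using form_eq_0_commute by (auto simp: orth_def)
  have si: "s \<in> B \<inter> orth {s}" using assms by (simp add: in_orth_singleton alternating)
  show "B \<inter> orth {s} \<in> tangential k" "Rad (B \<inter> orth {s}) = span {s}"
    using tangentialI[OF subspace_inter[OF B subspace_orth] d assms(4) si so v] by auto
qed

text \<open>Since \<open>x\<close> is orthogonal to \<open>X\<close>, one inclusion is clear, and
  both sides have dimension \<open>k\<close>. With \<open>regular_hyperplane\<close>, the points of
  \<open>B\<close> thus parametrize its tangential hyperplanes.\<close>

lemma tangential_in_regular: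
  assumes "regular B" "dim B = k + 1" "X \<in> tangential k" "X \<subseteq> B" "Rad X = span {x}" "x \<noteq> 0"
  shows "X = B \<inter> orth {x}"
proof -
  have "x \<in> Rad X" using assms by (auto intro: span_base)
  then have x: "x \<in> X" "x \<in> orth X" by (auto simp: Rad_def)
  then have "X \<subseteq> orth {x}" using subset_orth_commute[of X "{x}"] by simp
  moreover have "B \<inter> orth {x} \<in> tangential k"
    using regular_hyperplane(1)[of B k x] assms x by auto
  ultimately show ?thesis using assms(3,4) tangentialD
    by (intro subspace_dim_equal) auto
qed

text \<open>If \<open>s\<close> and \<open>t\<close> are orthogonal, then \<open>s\<close> is a
  radical vector of the intersection. Otherwise \<open>s\<close> and the intersection span the first
  hyperplane, so a radical vector of the intersection is a multiple of \<open>s\<close> orthogonal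
  to \<open>t\<close>, hence 0.\<close>

lemma smile_in_regular:
  assumes "odd k" "regular B" "dim B = k + 1" "s \<in> B" "s \<noteq> 0" "t \<in> B" "t \<noteq> 0"
  shows "smile k (B \<inter> orth {s}) (B \<inter> orth {t}) \<longleftrightarrow> \<xi> s t \<noteq> 0"
proof
  let ?S = "B \<inter> orth {s}" and ?T = "B \<inter> orth {t}"
  have S: "?S \<in> tangential k" "Rad ?S = span {s}" and T: "?T \<in> tangential k"
    using regular_hyperplane[of B k s] regular_hyperplane[of B k t] assms by auto
  note sS = tangentialD[OF S(1)]
  show "\<xi> s t \<noteq> 0" if "smile k ?S ?T"
  proof
    assume "\<xi> s t = 0"
    then have "s \<in> ?S \<inter> ?T" "s \<in> orth (?S \<inter> ?T)"
      using assms form_eq_0_commute by (auto simp: orth_def alternating)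
    then show False using that regularD[of "?S \<inter> ?T" s] assms by (auto simp: smile_iff)
  qed
  assume st: "\<xi> s t \<noteq> 0"
  have sS': "s \<in> ?S" using assms by (simp add: in_orth_singleton alternating)
  have I: "?S \<inter> ?T = ?S \<inter> orth {t}" by auto
  have d: "dim (?S \<inter> ?T) + 1 = k"
    unfolding I using dim_Int_orth_singleton[OF sS(1) sS' st] sS by simp
  have span: "span (insert s (?S \<inter> ?T)) = ?S"
    using sS d sS' st by (intro span_insert_hyperplane) (auto simp: I subspace_inter in_orth_singleton)
  have "regular (?S \<inter> ?T)"
  proof (rule regularI)
    show "subspace (?S \<inter> ?T)" unfolding I using sS by (simp add: subspace_inter)
    fix v assume v: "v \<in> ?S \<inter> ?T" "v \<in> orth (?S \<inter> ?T)"
    then have "v \<in> orth (insert s (?S \<inter> ?T))" by (auto simp: orth_insert[of s "?S \<inter> ?T"])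
    then have "v \<in> orth ?S" using span orth_span by metis
    then have "v \<in> span {s}" using v S(2) by (auto simp: Rad_def)
    then obtain c where c: "v = c *s s" by (auto simp: span_singleton)
    then have "c = 0" using v st by (auto simp: in_orth_singleton form_simps)
    then show "v = 0" using c by simp
  qed
  then show "smile k ?S ?T" using S T d assms by (simp add: smile_iff)
qed


text \<open>The line \<open>Rad B\<close> meets the hyperplane \<open>X\<close> in at least a point,
  everything in this intersection is orthogonal to \<open>X\<close>, and \<open>Rad X\<close> is
  only a point.\<close>

lemma Rad_in_degenerate:
  assumes "subspace B" "dim B = k + 1" "rdim B = 2" "X \<in> tangential k" "X \<subseteq> B"
  shows "Rad X = Rad B \<inter> X"
proof -
  note X = tangentialD[OF assms(4)]
  have "dim (Rad B) \<le> dim (Rad B \<inter> X) + 1"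
    using assms X by (intro dim_le_dim_Int_hyperplane[of X B]) (auto simp: Rad_subset)
  then have "dim (Rad X) \<le> dim (Rad B \<inter> X)" using assms X by (simp add: rdim_def)
  moreover have "Rad B \<inter> X \<subseteq> Rad X" using orth_antimono[OF assms(5)] by (auto simp: Rad_def)
  ultimately show ?thesis using assms X by (intro subspace_dim_equal[symmetric]) (auto simp: subspace_inter)
qed

text \<open>A common radical lies in the intersection and makes it degenerate. If the radicals
  differ, each of \<open>X\<close> and \<open>Y\<close> is spanned by its radical and the
  intersection, so a radical vector of the intersection belongs to both radicals and is 0.\<close>

lemma smile_in_degenerate:
  assumes k: "odd k" and B: "subspace B" "dim B = k + 1" "rdim B = 2"
    and X: "X \<in> tangential k" "X \<subseteq> B" and Y: "Y \<in> tangential k" "Y \<subseteq> B"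
  shows "smile k X Y \<longleftrightarrow> Rad X \<noteq> Rad Y"
proof
  note RX = Rad_in_degenerate[OF B X] and RY = Rad_in_degenerate[OF B Y]
  note sX = tangentialD[OF X(1)] and sY = tangentialD[OF Y(1)]
  show "Rad X \<noteq> Rad Y" if "smile k X Y"
  proof
    assume "Rad X = Rad Y"
    moreover obtain p where "p \<noteq> 0" "Rad X = span {p}" "p \<in> X" "p \<in> orth X"
      using tangentialE[OF X(1)] .
    ultimately have "p \<noteq> 0" "p \<in> X \<inter> Y" "p \<in> orth (X \<inter> Y)"
      using RY span_base[of p "{p}"] orth_antimono[of "X \<inter> Y" X] by auto
    then show False using that regularD[of "X \<inter> Y"] k by (auto simp: smile_iff)
  qed
  assume ne: "Rad X \<noteq> Rad Y"
  have *: "v \<in> Rad X"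
    if X: "X \<in> tangential k" "X \<subseteq> B" and Y: "Y \<in> tangential k" "Y \<subseteq> B" and ne: "Rad X \<noteq> Rad Y"
      and d: "dim (X \<inter> Y) + 1 = k" and v: "v \<in> X \<inter> Y" "v \<in> orth (X \<inter> Y)" for X Y v
  proof -
    obtain x where x: "x \<noteq> 0" "Rad X = span {x}" "x \<in> X" "x \<in> orth X"
      using tangentialE[OF X(1)] .
    obtain y where y: "y \<noteq> 0" "Rad Y = span {y}" using tangentialE[OF Y(1)] by blast
    have "x \<notin> Y"
    proof
      assume "x \<in> Y"
      then have "x \<in> Rad Y"
        using x Rad_in_degenerate[OF B Y] Rad_in_degenerate[OF B X] span_base[of x "{x}"] by auto
      then show False using x y ne span_singleton_eqI[of x y] by auto
    qed
    then have span: "span (insert x (X \<inter> Y)) = X"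
      using x d tangentialD[OF X(1)] tangentialD[OF Y(1)]
      by (intro span_insert_hyperplane) (auto simp: subspace_inter)
    have "\<xi> v x = 0" using v x form_eq_0_commute by (auto simp: orth_def)
    then have "v \<in> orth (span (insert x (X \<inter> Y)))" using v unfolding in_orth_span by (auto simp: orth_def)
    then show ?thesis using v span by (simp add: Rad_def)
  qed
  have "dim (X \<inter> Y) \<ge> k - 1"
    using dim_le_dim_Int_hyperplane[of Y B X] X Y B sX sY by auto
  moreover have "\<not> dim (X \<inter> Y) \<ge> k"
  proof
    assume d: "dim (X \<inter> Y) \<ge> k"
    have "X \<inter> Y = X" by (rule subspace_dim_equal) (use d sX sY in \<open>auto simp: subspace_inter\<close>)
    moreover have "X \<inter> Y = Y" by (rule subspace_dim_equal) (use d sX sY in \<open>auto simp: subspace_inter\<close>)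
    ultimately show False using ne by auto
  qed
  ultimately have d: "dim (X \<inter> Y) + 1 = k" by auto
  have "regular (X \<inter> Y)"
  proof (rule regularI)
    show "subspace (X \<inter> Y)" using sX sY by (simp add: subspace_inter)
    fix v assume v: "v \<in> X \<inter> Y" "v \<in> orth (X \<inter> Y)"
    have vX: "v \<in> Rad X" using *[OF X Y ne d v] .
    have vY: "v \<in> Rad Y" using *[OF Y X] ne d v by (simp add: Int_commute)
    show "v = 0"
    proof (rule ccontr)
      assume "v \<noteq> 0"
      obtain x where x: "Rad X = span {x}" using tangentialE[OF X(1)] by blast
      obtain y where y: "Rad Y = span {y}" using tangentialE[OF Y(1)] by blast
      show False using ne x y vX vY \<open>v \<noteq> 0\<close> span_singleton_eqI[of v x] span_singleton_eqI[of v y] by simp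
    qed
  qed
  then show "smile k X Y" using d X Y k by (simp add: smile_iff)
qed

text \<open>Cutting with \<open>orth {c}\<close> shrinks the radical line to its point
  \<open>span {u}\<close>. No new radical vectors appear, because the vector \<open>r\<close> that
  restores \<open>B\<close> is orthogonal to all of \<open>B\<close>.\<close>

lemma degenerate_hyperplane:
  assumes B: "subspace B" "dim B = k + 1" "rdim B = 2"
    and u: "u \<in> Rad B" "u \<noteq> 0" and c: "\<xi> u c = 0" and r: "r \<in> Rad B" "\<xi> r c \<noteq> 0"
  shows "B \<inter> orth {c} \<in> tangential k" "Rad (B \<inter> orth {c}) = span {u}"
proof -
  have rB: "r \<in> B" "r \<in> orth B" and uB: "u \<in> B" "u \<in> orth B" using r u by (auto simp: Rad_def)
  have d: "dim (B \<inter> orth {c}) = k" using dim_Int_orth_singleton[OF B(1) rB(1) r(2)] B by simp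
  have span: "span (insert r (B \<inter> orth {c})) = B"
    using rB B d r by (intro span_insert_hyperplane) (auto simp: subspace_inter in_orth_singleton)
  have d1: "dim (Rad B \<inter> orth {c}) = 1"
    using dim_Int_orth_singleton[of "Rad B" r c] B r by (simp add: rdim_def)
  obtain w where w: "Rad B \<inter> orth {c} = span {w}" using dim_eq_1_E[OF _ d1] B by (auto simp: subspace_inter)
  have "u \<in> Rad B \<inter> orth {c}" using u c by (simp add: in_orth_singleton)
  then have uw: "Rad B \<inter> orth {c} = span {u}" using w u span_singleton_eqI by simp
  have v: "v \<in> span {u}" if v: "v \<in> B \<inter> orth {c}" "v \<in> orth (B \<inter> orth {c})" for v
  proof -
    have "\<xi> v r = 0" using v rB form_eq_0_commute by (auto simp: orth_def)
    then have "v \<in> orth (span (insert r (B \<inter> orth {c})))"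
      using v(2) unfolding in_orth_span by (auto simp: orth_def)
    then have "v \<in> Rad B \<inter> orth {c}" using v(1) span by (simp add: Rad_def)
    then show ?thesis using uw by simp
  qed
  have ui: "u \<in> B \<inter> orth {c}" using uB c by (simp add: in_orth_singleton)
  have uo: "u \<in> orth (B \<inter> orth {c})" using uB orth_antimono[of "B \<inter> orth {c}" B] by auto
  show "B \<inter> orth {c} \<in> tangential k" "Rad (B \<inter> orth {c}) = span {u}"
    using tangentialI[OF subspace_inter[OF B(1) subspace_orth] d u(2) ui uo v] by auto
qed

text \<open>The vector \<open>c\<close> selects the point \<open>span {u}\<close> of the radical
  line. Adding a vector \<open>b\<close> orthogonal to \<open>Rad B\<close> but not to
  \<open>B\<close> changes the hyperplane and keeps its radical; such a \<open>b\<close> exists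
  because \<open>k \<ge> 2\<close> makes \<open>B\<close> larger than \<open>Rad B\<close>.\<close>

lemma exists_degenerate_hyperplanes:
  assumes B: "subspace B" "dim B = k + 1" "rdim B = 2" and k: "k \<ge> 2"
    and u: "u \<in> Rad B" "u \<noteq> 0"
  obtains Y Y' where "Y \<in> tangential k" "Rad Y = span {u}" "Y \<subseteq> B"
    "Y' \<in> tangential k" "Rad Y' = span {u}" "Y' \<subseteq> B" "Y \<noteq> Y'"
proof -
  have "\<not> Rad B \<subseteq> span {u}" using dim_mono[of "Rad B" "{u}"] B u by (auto simp: rdim_def)
  then obtain r where r: "r \<in> Rad B" "r \<notin> span {u}" by auto
  have rB: "r \<in> B" "r \<in> orth B" and uB: "u \<in> B" "u \<in> orth B" using r u by (auto simp: Rad_def)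
  have "\<not> orth (span {u}) \<subseteq> orth (span {r})"
    using orth_subset_iff[of "span {u}" "span {r}"] r span_base[of r "{r}"] by auto
  then obtain c where c: "\<xi> c u = 0" "\<xi> c r \<noteq> 0"
    using in_orth_singleton by (metis orth_span subsetI)
  have "\<not> orth (Rad B) \<subseteq> orth B"
    using orth_subset_iff[of "Rad B" B] dim_subset[of B "Rad B"] B k by (auto simp: rdim_def)
  then obtain b where b: "b \<in> orth (Rad B)" "b \<notin> orth B" by auto
  obtain a where a: "a \<in> B" "\<xi> a b \<noteq> 0" using b(2) form_eq_0_commute by (auto simp: orth_def)
  have uc: "\<xi> u c = 0" "\<xi> r c \<noteq> 0" using c form_eq_0_commute by blast+
  have ub: "\<xi> u b = 0" "\<xi> r b = 0" using b(1) r u form_eq_0_commute by (auto simp: orth_def)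
  let ?Y = "B \<inter> orth {c}" and ?Y' = "B \<inter> orth {c + b}"
  \<comment> \<open>The multiple of \<open>r\<close> makes \<open>?a\<close> orthogonal to
    \<open>c\<close>. As \<open>r\<close> is orthogonal to \<open>b\<close>, the value
    \<open>\<xi> a b\<close> survives and separates the two hyperplanes.\<close>
  let ?a = "a - (\<xi> a c / \<xi> r c) *s r"
  have "?a \<in> B" using a rB B by (simp add: subspace_diff subspace_scale)
  moreover have "\<xi> ?a c = 0" "\<xi> ?a (c + b) = \<xi> a b"
    using uc ub by (simp_all add: form_simps)
  ultimately have "?a \<in> ?Y" "?a \<notin> ?Y'" using a by (simp_all add: in_orth_singleton)
  then have "?Y \<noteq> ?Y'" by blast
  moreover have "?Y \<in> tangential k" "Rad ?Y = span {u}"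
    using degenerate_hyperplane[OF B u uc(1) r(1) uc(2)] by auto
  moreover have "?Y' \<in> tangential k" "Rad ?Y' = span {u}"
    using degenerate_hyperplane[OF B u, of "c + b" r] r uc ub by (auto simp: form_simps)
  ultimately show thesis using that by blast
qed

text \<open>The sum of two neighbours is of one of two types, decided by \<open>\<xi> p q\<close>:
  it is regular, or its radical is the line joining the two radicals. Both cases start from the
  normal forms of \<open>U\<close> and \<open>W\<close> over their common hyperplane
  \<open>U \<inter> W\<close>.\<close>

lemma smile_sum:
  assumes k: "odd k" and UW: "smile k U W" and p: "Rad U = span {p}" "p \<noteq> 0" and q: "Rad W = span {q}" "q \<noteq> 0"
  shows "dim (span (U \<union> W)) = k + 1" "span (U \<union> W) = span (insert q U)" "q \<notin> U"
    "p \<in> U" "q \<in> W" "p \<in> orth U" "q \<in> orth W" "p \<in> orth (U \<inter> W)" "q \<in> orth (U \<inter> W)"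
    "span {p} \<noteq> span {q}" "p \<notin> W"
    "\<xi> p q \<noteq> 0 \<Longrightarrow> regular (span (U \<union> W))"
    "\<xi> p q = 0 \<Longrightarrow> rdim (span (U \<union> W)) = 2"
    "\<xi> p q = 0 \<Longrightarrow> Rad (span (U \<union> W)) = span {p, q}"
proof -
  let ?M = "U \<inter> W"
  have U: "U \<in> tangential k" and W: "W \<in> tangential k" and M: "regular ?M" and d: "dim ?M + 1 = k"
    using UW k by (auto simp: smile_iff)
  note sU = tangentialD[OF U] and sW = tangentialD[OF W]
  have U': "U \<in> tangential (dim ?M + 1)" and W': "W \<in> tangential (dim ?M + 1)" using U W d by simp_all
  note p1 = tangential_eq_insert[OF M Int_lower1 U' p]
  note q1 = tangential_eq_insert[OF M Int_lower2 W' q]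
  show q': "q \<notin> U" and p': "p \<notin> W" using p1(4,5) q1(4,5) by auto
  show "p \<in> U" "q \<in> W" "p \<in> orth U" "q \<in> orth W" "p \<in> orth ?M" "q \<in> orth ?M" using p1(2-4) q1(2-4) by auto
  show B: "span (U \<union> W) = span (insert q U)"
  proof
    have "W \<subseteq> span (insert q U)" by (subst q1(1), rule span_mono) auto
    then show "span (U \<union> W) \<subseteq> span (insert q U)" by (intro span_minimal) (auto intro: span_base)
    show "span (insert q U) \<subseteq> span (U \<union> W)" using q1(4) by (intro span_mono) auto
  qed
  show dB: "dim (span (U \<union> W)) = k + 1"
    using q' sU by (simp add: B dim_insert span_of_subspace)
  show pq: "span {p} \<noteq> span {q}"
  proof
    assume "span {p} = span {q}"
    then have "q \<in> span {p}" by (simp add: span_base)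
    then show False using q' p1(4) sU span_minimal[of "{p}" U] by auto
  qed
  show "regular (span (U \<union> W))" if pq: "\<xi> p q \<noteq> 0"
  proof (rule regularI)
    fix v assume v: "v \<in> span (U \<union> W)" "v \<in> orth (span (U \<union> W))"
    have vU: "v \<in> orth U" "v \<in> orth W" using v(2) by (auto simp: orth_Un)
    obtain c where c: "v - c *s q \<in> U" using v(1) B sU by (auto simp: span_breakdown_eq span_of_subspace)
    have "\<xi> (v - c *s q) p = 0" using c p1(3) form_eq_0_commute by (auto simp: orth_def)
    moreover have "\<xi> v p = 0" using vU p1(4) by (auto simp: orth_def)
    ultimately have "c * \<xi> q p = 0" by (simp add: form_simps)
    then have "c = 0" using pq form_eq_0_commute by auto
    then have "v \<in> Rad U" using c vU by (simp add: Rad_def)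
    then obtain e where e: "v = e *s p" using p by (auto simp: span_singleton)
    have "\<xi> v q = 0" using vU q1(4) by (auto simp: orth_def)
    then show "v = 0" using pq e by (simp add: form_simps)
  qed simp
  assume pq0: "\<xi> p q = 0"
  have *: "p \<in> Rad (span (U \<union> W))" "q \<in> Rad (span (U \<union> W))"
  proof -
    have "q \<in> orth {p}" "p \<in> orth {q}" using pq0 form_eq_0_commute by (auto simp: in_orth_singleton)
    then have "q \<in> orth (span (insert p ?M))" "p \<in> orth (span (insert q ?M))"
      using q1(2) p1(2) orth_insert[of p ?M] orth_insert[of q ?M] orth_span by auto
    then have "q \<in> orth U" "p \<in> orth W" using p1(1) q1(1) by simp_all
    then show "p \<in> Rad (span (U \<union> W))" "q \<in> Rad (span (U \<union> W))"
      using p1(3,4) q1(3,4) by (auto simp: Rad_def orth_Un intro: span_base)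
  qed
  \<comment> \<open>The radical exceeds its intersection with the hyperplane \<open>U\<close> by at
    most one dimension, and that intersection lies in the point \<open>Rad U\<close>.\<close>
  have "dim (Rad (span (U \<union> W))) \<le> dim (Rad (span (U \<union> W)) \<inter> U) + 1"
    using sU dB by (intro dim_le_dim_Int_hyperplane[of U "span (U \<union> W)"]) (auto simp: Rad_subset intro: span_base)
  moreover have "Rad (span (U \<union> W)) \<inter> U \<subseteq> Rad U"
    by (auto simp: Rad_def orth_Un)
  then have "dim (Rad (span (U \<union> W)) \<inter> U) \<le> 1" using dim_subset sU by metis
  ultimately have le: "rdim (span (U \<union> W)) \<le> 2" by (simp add: rdim_def)
  have sub: "span {p, q} \<subseteq> Rad (span (U \<union> W))" using * by (intro span_minimal) auto
  have "p \<notin> span {q}" using pq p span_singleton_eqI by blast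
  then have dd: "dim (span {p, q}) = 2" using q by (simp add: dim_insert)
  show R: "Rad (span (U \<union> W)) = span {p, q}"
    by (rule subspace_dim_equal[symmetric]) (use sub le dd in \<open>simp_all add: rdim_def del: dim_span\<close>)
  show "rdim (span (U \<union> W)) = 2" using R dd by (simp add: rdim_def)
qed

text \<open>Two different hyperplanes of \<open>X\<close>, here those cut out by \<open>U\<close>
  and \<open>W\<close>, together span \<open>X\<close>.\<close>

lemma subset_sum_of_intersections:
  assumes X: "subspace X" "dim X = k" and UX: "dim (U \<inter> X) + 1 = k" and WX: "dim (W \<inter> X) + 1 = k"
    and U: "subspace U" and W: "subspace W" and ne: "U \<inter> X \<noteq> W \<inter> X"
  shows "X \<subseteq> span (U \<union> W)"
proof -
  have "\<not> W \<inter> X \<subseteq> U \<inter> X"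
  proof
    assume *: "W \<inter> X \<subseteq> U \<inter> X"
    have "W \<inter> X = U \<inter> X"
      by (rule subspace_dim_equal) (use * UX WX U W X in \<open>auto simp: subspace_inter\<close>)
    then show False using ne by simp
  qed
  then obtain w where w: "w \<in> W" "w \<in> X" "w \<notin> U" by auto
  have "span (insert w (U \<inter> X)) = X"
    using w X UX U by (intro span_insert_hyperplane) (auto simp: subspace_inter)
  moreover have "span (insert w (U \<inter> X)) \<subseteq> span (U \<union> W)" using w by (intro span_mono) auto
  ultimately show ?thesis by simp
qed

subsection \<open>Common neighbours\<close>

definition common_nbrs_clique :: "nat \<Rightarrow> 'v set \<Rightarrow> 'v set \<Rightarrow> 'v set \<Rightarrow> bool" where
  "common_nbrs_clique k U W X \<longleftrightarrow>
     (\<forall>Y\<in>tangential k. \<forall>Y'\<in>tangential k. smile k U Y \<and> smile k W Y \<and> smile k X Y \<and>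
        smile k U Y' \<and> smile k W Y' \<and> smile k X Y' \<longrightarrow> Y = Y' \<or> smile k Y Y')"

text \<open>Not lying in the sum, \<open>X\<close> must pass through \<open>U \<inter> W\<close>.
  Every common neighbour does so too, and two different \<open>k\<close>-subspaces through this
  regular \<open>(k - 1)\<close>-subspace meet exactly in it.\<close>

lemma common_nbrs_clique_if_not_subset:
  assumes k: "odd k" and s: "smile k U W" "smile k U X" "smile k W X" and X: "\<not> X \<subseteq> span (U \<union> W)"
  shows "common_nbrs_clique k U W X"
proof -
  let ?M = "U \<inter> W"
  have U: "U \<in> tangential k" and W: "W \<in> tangential k" and tX: "X \<in> tangential k"
    and M: "regular ?M" and d: "dim ?M + 1 = k" "dim (U \<inter> X) + 1 = k" "dim (W \<inter> X) + 1 = k"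
    using s k by (auto simp: smile_iff)
  note sU = tangentialD[OF U] and sW = tangentialD[OF W] and sX = tangentialD[OF tX]
  have "U \<inter> X = W \<inter> X"
    using X subset_sum_of_intersections[OF sX(1,2) d(2,3) sU(1) sW(1)] by blast
  then have MX': "U \<inter> X \<subseteq> ?M" by auto
  have "U \<inter> X = ?M"
    by (rule subspace_dim_equal) (use MX' d sU sW sX in \<open>auto simp: subspace_inter\<close>)
  then have MX: "?M \<subseteq> X" by auto
  \<comment> \<open>If \<open>Y\<close> did not contain \<open>?M\<close>, it would lie in
    \<open>span (U \<union> W)\<close>, which meets \<open>X\<close> only in \<open>?M\<close>. Then
    \<open>X \<inter> Y\<close>, having the dimension of \<open>?M\<close>, would equal
    \<open>?M\<close>.\<close>
  have *: "?M \<subseteq> Y" if Y: "smile k U Y" "smile k W Y" "smile k X Y" for Y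
  proof (rule ccontr)
    assume nY: "\<not> ?M \<subseteq> Y"
    have tY: "Y \<in> tangential k"
      and dY: "dim (U \<inter> Y) + 1 = k" "dim (W \<inter> Y) + 1 = k" "dim (X \<inter> Y) + 1 = k"
      using Y k by (auto simp: smile_iff)
    note sY = tangentialD[OF tY]
    have "U \<inter> Y \<noteq> W \<inter> Y"
    proof
      assume "U \<inter> Y = W \<inter> Y"
      then have sub: "U \<inter> Y \<subseteq> ?M" by auto
      have "U \<inter> Y = ?M"
        by (rule subspace_dim_equal) (use sub dY d sU sW sY in \<open>auto simp: subspace_inter\<close>)
      then show False using nY by auto
    qed
    then have YB: "Y \<subseteq> span (U \<union> W)"
      using subset_sum_of_intersections[OF sY(1,2) dY(1,2) sU(1) sW(1)] by blast
    let ?B = "span (U \<union> W)"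
    have MXB: "?M \<subseteq> X \<inter> ?B" using MX by (auto intro: span_base)
    have "\<not> dim (X \<inter> ?B) \<ge> k"
    proof
      assume dd: "dim (X \<inter> ?B) \<ge> k"
      have "X \<inter> ?B = X" by (rule subspace_dim_equal) (use dd sX in \<open>auto simp: subspace_inter\<close>)
      then show False using X by auto
    qed
    then have "?M = X \<inter> ?B"
      using MXB d by (intro subspace_dim_equal) (use sX sU sW in \<open>auto simp: subspace_inter\<close>)
    then have sub: "X \<inter> Y \<subseteq> ?M" using YB by auto
    have "X \<inter> Y = ?M"
      by (rule subspace_dim_equal) (use sub dY d sU sW sY sX in \<open>auto simp: subspace_inter\<close>)
    then show False using nY by auto
  qed
  show ?thesis unfolding common_nbrs_clique_def
  proof (intro ballI impI)
    fix Y Y' assume t: "Y \<in> tangential k" "Y' \<in> tangential k" and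
      Y: "smile k U Y \<and> smile k W Y \<and> smile k X Y \<and> smile k U Y' \<and> smile k W Y' \<and> smile k X Y'"
    have sub: "?M \<subseteq> Y \<inter> Y'" using * Y by blast
    note sY = tangentialD[OF t(1)] and sY' = tangentialD[OF t(2)]
    show "Y = Y' \<or> smile k Y Y'"
    proof (cases "dim (Y \<inter> Y') \<ge> k")
      case True
      have "Y \<inter> Y' = Y" by (rule subspace_dim_equal) (use True sY sY' in \<open>auto simp: subspace_inter\<close>)
      moreover have "Y \<inter> Y' = Y'" by (rule subspace_dim_equal) (use True sY sY' in \<open>auto simp: subspace_inter\<close>)
      ultimately show ?thesis by auto
    next
      case False
      have "?M = Y \<inter> Y'"
        by (rule subspace_dim_equal) (use sub False d sU sW sY sY' in \<open>auto simp: subspace_inter\<close>)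
      then show ?thesis using M d t k by (simp add: smile_iff)
    qed
  qed
qed


lemma two_neq_0: "(2 :: 'k) \<noteq> 0"
proof
  assume "(2 :: 'k) = 0"
  then have "of_nat 2 = (0 :: 'k)" by simp
  then have "CHAR('k) dvd 2" by (simp only: of_nat_eq_0_iff_char_dvd)
  then have "CHAR('k) \<le> 2" "CHAR('k) \<noteq> 0" by (auto dest: dvd_imp_le intro!: Nat.gr0I)
  then have "CHAR('k) = 1" using char_neq_2 by linarith
  then show False using of_nat_CHAR[where 'a='k] by simp
qed

text \<open>For \<open>x = a p + b q\<close> the point of \<open>a p - b q\<close> is new because
  \<open>2 \<noteq> 0\<close>. It will be the radical of further common neighbours of three
  subspaces with radicals on one line.\<close>

lemma harmonic_conjugate:
  assumes "p \<noteq> 0" "q \<noteq> 0" "span {p} \<noteq> span {q}" "x \<in> span {p, q}" "x \<noteq> 0"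
    "span {p} \<noteq> span {x}" "span {q} \<noteq> span {x}"
  obtains y where "y \<in> span {p, q}" "y \<noteq> 0"
    "span {p} \<noteq> span {y}" "span {q} \<noteq> span {y}" "span {x} \<noteq> span {y}"
proof -
  obtain a where "x - a *s p \<in> span {q}" using assms(4) by (auto simp: span_breakdown_eq)
  then obtain b where b: "x - a *s p = b *s q" by (auto simp: span_singleton)
  then have x: "x = a *s p + b *s q" by (simp add: algebra_simps)
  have a0: "a \<noteq> 0" using x assms span_singleton_eqI[of x q] by (auto simp: span_singleton)
  have b0: "b \<noteq> 0" using x assms span_singleton_eqI[of x p] by (auto simp: span_singleton)
  have indep: "c = 0 \<and> d = 0" if e: "c *s p = d *s q" for c d
  proof -
    have "c = 0"
    proof (rule ccontr)
      assume "c \<noteq> 0"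
      then have "p = (d / c) *s q"
        using arg_cong[OF e, of "\<lambda>v. (1 / c) *s v"] by simp
      then have "p \<in> span {q}" by (auto simp: span_singleton)
      then show False using assms span_singleton_eqI[of p q] by auto
    qed
    then show ?thesis using e assms by auto
  qed
  let ?y = "a *s p - b *s q"
  have "?y \<in> span {p, q}" by (intro span_diff span_scale span_base) auto
  moreover have "?y \<noteq> 0" using indep[of a b] a0 by auto
  moreover have "span {p} \<noteq> span {?y}"
  proof
    assume "span {p} = span {?y}"
    then have "?y \<in> span {p}" by (simp add: span_base)
    then obtain c where "a *s p - b *s q = c *s p" by (auto simp: span_singleton)
    then have "(a - c) *s p = b *s q" by (simp add: algebra_simps)
    then show False using indep b0 by blast
  qed
  moreover have "span {q} \<noteq> span {?y}"
  proof
    assume "span {q} = span {?y}"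
    then have "?y \<in> span {q}" by (simp add: span_base)
    then obtain c where "a *s p - b *s q = c *s q" by (auto simp: span_singleton)
    then have "a *s p = (b + c) *s q" by (simp add: algebra_simps)
    then show False using indep a0 by blast
  qed
  moreover have "span {x} \<noteq> span {?y}"
  proof
    assume "span {x} = span {?y}"
    then have "?y \<in> span {x}" by (simp add: span_base)
    then obtain c where "a *s p - b *s q = c *s x" by (auto simp: span_singleton)
    then have "(a - c * a) *s p = (c * b + b) *s q" unfolding x by (simp add: algebra_simps)
    then have "a * (1 - c) = 0" "b * (c + 1) = 0" using indep by (fastforce simp: algebra_simps)+
    then have "c = 1" "c + 1 = 0" using a0 b0 by auto
    then show False using two_neq_0 by simp
  qed
  ultimately show thesis by (rule that)
qed

text \<open>Two different nonadjacent common neighbours are constructed. In a degenerate sum they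
  share as radical a fourth point of the radical line. In a regular sum their radicals are spanned
  by orthogonal vectors \<open>t\<close> and \<open>t'\<close>, neither of them orthogonal to
  \<open>p\<close>, \<open>q\<close> or \<open>x\<close>.\<close>

lemma not_common_nbrs_clique_if_subset:
  assumes k: "odd k" "3 \<le> k" and s: "smile k U W" "smile k U X" "smile k W X"
    and X: "X \<subseteq> span (U \<union> W)"
  shows "\<not> common_nbrs_clique k U W X"
proof -
  let ?B = "span (U \<union> W)"
  have tU: "U \<in> tangential k" and tW: "W \<in> tangential k" and tX: "X \<in> tangential k"
    using s k by (auto simp: smile_iff)
  obtain p where p: "p \<noteq> 0" "Rad U = span {p}" using tangentialE[OF tU] by blast
  obtain q where q: "q \<noteq> 0" "Rad W = span {q}" using tangentialE[OF tW] by blast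
  obtain x where x: "x \<noteq> 0" "Rad X = span {x}" "x \<in> X" using tangentialE[OF tX] by blast
  note S = smile_sum[OF k(1) s(1) p(2,1) q(2,1)]
  have UB: "U \<subseteq> ?B" and WB: "W \<subseteq> ?B" by (auto intro: span_base)
  show ?thesis
  proof (cases "\<xi> p q = 0")
    case True
    have B: "subspace ?B" "dim ?B = k + 1" "rdim ?B = 2" "Rad ?B = span {p, q}"
      using S(1) S(13,14)[OF True] by auto
    note sm = smile_in_degenerate[OF k(1) B(1-3)]
    have "x \<in> span {p, q}" using Rad_in_degenerate[OF B(1-3) tX X] B(4) x span_base[of x "{x}"] by auto
    moreover have "span {p} \<noteq> span {x}" "span {q} \<noteq> span {x}"
      using sm[OF tU UB tX X] sm[OF tW WB tX X] s p q x by auto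
    ultimately obtain y where y: "y \<in> span {p, q}" "y \<noteq> 0"
      "span {p} \<noteq> span {y}" "span {q} \<noteq> span {y}" "span {x} \<noteq> span {y}"
      using harmonic_conjugate[of p q x] p q x S(10) by metis
    obtain Y Y' where Y: "Y \<in> tangential k" "Rad Y = span {y}" "Y \<subseteq> ?B"
      "Y' \<in> tangential k" "Rad Y' = span {y}" "Y' \<subseteq> ?B" "Y \<noteq> Y'"
      using exists_degenerate_hyperplanes[OF B(1-3), of y] k y B(4) by auto
    have "smile k U Y" "smile k W Y" "smile k X Y" "smile k U Y'" "smile k W Y'" "smile k X Y'" "\<not> smile k Y Y'"
      using sm[OF tU UB Y(1,3)] sm[OF tW WB Y(1,3)] sm[OF tX X Y(1,3)]
        sm[OF tU UB Y(4,6)] sm[OF tW WB Y(4,6)] sm[OF tX X Y(4,6)] sm[OF Y(1,3) Y(4,6)] y p q x Y by auto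
    then show ?thesis using Y unfolding common_nbrs_clique_def by blast
  next
    case False
    have B: "regular ?B" "dim ?B = k + 1" using S(1) S(12)[OF False] by auto
    have U: "U = ?B \<inter> orth {p}" using tangential_in_regular[OF B tU UB p(2,1)] .
    have W: "W = ?B \<inter> orth {q}" using tangential_in_regular[OF B tW WB q(2,1)] .
    have XX: "X = ?B \<inter> orth {x}" using tangential_in_regular[OF B tX X x(2,1)] .
    have pB: "p \<in> ?B" and qB: "q \<in> ?B" and xB: "x \<in> ?B" using S(4,5) x(3) X UB WB by blast+
    note sm = smile_in_regular[OF k(1) B]
    have px: "\<xi> p x \<noteq> 0" using sm[OF pB p(1) xB x(1)] U XX s by simp
    have qx: "\<xi> q x \<noteq> 0" using sm[OF qB q(1) xB x(1)] W XX s by simp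
    have skew: "\<xi> q p = - \<xi> p q" "\<xi> x p = - \<xi> p x" "\<xi> x q = - \<xi> q x" by (rule form_skew)+
    \<comment> \<open>Three linear conditions on a space of dimension \<open>k + 1 \<ge> 4\<close>
      leave a nonzero solution \<open>z\<close>.\<close>
    have "card {p, q, x} \<le> 3" by (simp add: card_insert_if)
    moreover have "dim ?B \<le> dim (?B \<inter> orth {p, q, x}) + card {p, q, x}"
      by (rule dim_Int_orth_finite_ge) auto
    ultimately have "dim (?B \<inter> orth {p, q, x}) \<noteq> 0" using B(2) k(2) by linarith
    then have "\<not> ?B \<inter> orth {p, q, x} \<subseteq> {0}" by simp
    then obtain z where z: "z \<in> ?B" "z \<noteq> 0" "\<xi> z p = 0" "\<xi> z q = 0" "\<xi> z x = 0" by (auto simp: orth_def)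
    then have z': "\<xi> p z = 0" "\<xi> q z = 0" "\<xi> x z = 0" using form_eq_0_commute by blast+
    \<comment> \<open>\<open>t\<close> is a combination of \<open>p\<close> and \<open>q\<close>, so \<open>z\<close> is orthogonal to it; hence \<open>t\<close> and \<open>t + z\<close>
      give nonadjacent common neighbours.\<close>
    define t where "t = \<xi> x q *s p + \<xi> x p *s q"
    define t' where "t' = t + z"
    have t: "t \<in> ?B" "t' \<in> ?B" unfolding t'_def t_def using pB qB z by (auto intro!: span_add span_scale)
    \<comment> \<open>The coefficients of \<open>t\<close> turn its pairings with \<open>p\<close>
      and \<open>q\<close> into products of nonzero factors. With \<open>x\<close> the two terms add
      up instead of cancelling, which leaves the factor 2, nonzero by the assumption on the
      characteristic.\<close>
    have v: "\<xi> p t = \<xi> x p * \<xi> p q" "\<xi> q t = \<xi> x q * \<xi> q p" "\<xi> x t = 2 * (\<xi> x q * \<xi> x p)" "\<xi> t z = 0"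
      unfolding t_def using z' by (simp_all add: form_simps)
    have v': "\<xi> p t' = \<xi> p t" "\<xi> q t' = \<xi> q t" "\<xi> x t' = \<xi> x t" "\<xi> t t' = 0"
      unfolding t'_def using z' v(4) by (simp_all add: form_simps)
    have nz: "\<xi> p t \<noteq> 0" "\<xi> q t \<noteq> 0" "\<xi> x t \<noteq> 0"
      unfolding v using False px qx skew two_neq_0 by auto
    have t0: "t \<noteq> 0" "t' \<noteq> 0" using nz v' by auto
    let ?Y = "?B \<inter> orth {t}" and ?Y' = "?B \<inter> orth {t'}"
    have Y: "?Y \<in> tangential k" "Rad ?Y = span {t}" "?Y' \<in> tangential k" "Rad ?Y' = span {t'}"
      using regular_hyperplane[OF B] t t0 by auto
    have ne: "?Y \<noteq> ?Y'"
    proof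
      assume "?Y = ?Y'"
      then have "t' \<in> span {t}" using Y span_base[of t' "{t'}"] by auto
      then obtain c where c: "t' = c *s t" by (auto simp: span_singleton)
      then have "c = 1" using nz(1) v'(1) by (simp add: form_simps)
      then show False using c z by (simp add: t'_def)
    qed
    have "smile k U ?Y" "smile k W ?Y" "smile k X ?Y" "smile k U ?Y'" "smile k W ?Y'" "smile k X ?Y'"
      using sm[OF pB p(1) t(1) t0(1)] sm[OF qB q(1) t(1) t0(1)] sm[OF xB x(1) t(1) t0(1)]
        sm[OF pB p(1) t(2) t0(2)] sm[OF qB q(1) t(2) t0(2)] sm[OF xB x(1) t(2) t0(2)]
        U W XX nz v' by simp_all
    moreover have "\<not> smile k ?Y ?Y'" using sm[OF t(1) t0(1) t(2) t0(2)] v'(4) by simp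
    ultimately show ?thesis using Y ne unfolding common_nbrs_clique_def by blast
  qed
qed

text \<open>For neighbours \<open>U\<close>, \<open>W\<close> this expresses that \<open>X\<close>
  is a common neighbour inside \<open>span (U \<union> W)\<close>, using adjacency only; see
  \<open>top_nbr_iff\<close>.\<close>

definition top_nbr :: "nat \<Rightarrow> 'v set \<Rightarrow> 'v set \<Rightarrow> 'v set \<Rightarrow> bool" where
  "top_nbr k U W X \<longleftrightarrow> smile k U X \<and> smile k W X \<and> \<not> common_nbrs_clique k U W X"

lemma top_nbr_iff:
  assumes "odd k" "3 \<le> k" "smile k U W"
  shows "top_nbr k U W X \<longleftrightarrow> smile k U X \<and> smile k W X \<and> X \<subseteq> span (U \<union> W)"
  unfolding top_nbr_def
  using common_nbrs_clique_if_not_subset[OF assms(1,3), of X]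
    not_common_nbrs_clique_if_subset[OF assms, of X] by blast

text \<open>The excluded triple violates transitivity of nonadjacency among the common neighbours
  inside the sum. For neighbours and odd \<open>k \<ge> 3\<close> it exists exactly when the sum is
  regular.\<close>

definition perp_smile :: "nat \<Rightarrow> 'v set \<Rightarrow> 'v set \<Rightarrow> bool" where
  "perp_smile k U W \<longleftrightarrow> smile k U W \<and>
     \<not> (\<exists>X\<in>tangential k. \<exists>Y\<in>tangential k. \<exists>Y'\<in>tangential k.
         top_nbr k U W X \<and> top_nbr k U W Y \<and> top_nbr k U W Y' \<and>
         \<not> smile k X Y \<and> \<not> smile k X Y' \<and> smile k Y Y')"

lemma perp_smile_iff:
  assumes k: "odd k" "3 \<le> k"
  shows "perp_smile k U W \<longleftrightarrow> smile k U W \<and> perp (Rad U) (Rad W)"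
proof (cases "smile k U W")
  case s: True
  let ?B = "span (U \<union> W)"
  have tU: "U \<in> tangential k" and tW: "W \<in> tangential k" using s k by (auto simp: smile_iff)
  obtain p where p: "p \<noteq> 0" "Rad U = span {p}" using tangentialE[OF tU] by blast
  obtain q where q: "q \<noteq> 0" "Rad W = span {q}" using tangentialE[OF tW] by blast
  note S = smile_sum[OF k(1) s p(2,1) q(2,1)]
  have UB: "U \<subseteq> ?B" and WB: "W \<subseteq> ?B" by (auto intro: span_base)
  note top = top_nbr_iff[OF k s]
  show ?thesis
  proof (cases "\<xi> p q = 0")
    case True
    have B: "subspace ?B" "dim ?B = k + 1" "rdim ?B = 2" using S(1) S(13)[OF True] by auto
    note sm = smile_in_degenerate[OF k(1) B]
    have "smile k X Y \<or> smile k X Y' \<or> \<not> smile k Y Y'"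
      if "X \<in> tangential k" "Y \<in> tangential k" "Y' \<in> tangential k"
        "top_nbr k U W X" "top_nbr k U W Y" "top_nbr k U W Y'" for X Y Y'
      using that sm[of X Y] sm[of X Y'] sm[of Y Y'] unfolding top by auto
    then have "perp_smile k U W" using s unfolding perp_smile_def by blast
    then show ?thesis using s True p q by (simp add: perp_span)
  next
    case False
    have B: "regular ?B" "dim ?B = k + 1" using S(1) S(12)[OF False] by auto
    have U: "U = ?B \<inter> orth {p}" using tangential_in_regular[OF B tU UB p(2,1)] .
    have W: "W = ?B \<inter> orth {q}" using tangential_in_regular[OF B tW WB q(2,1)] .
    have pB: "p \<in> ?B" and qB: "q \<in> ?B" using S(4,5) UB WB by blast+
    note sm = smile_in_regular[OF k(1) B]
    have M: "regular (U \<inter> W)" "dim (U \<inter> W) + 1 = k" using s k by (auto simp: smile_iff)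
    \<comment> \<open>Because \<open>k \<ge> 3\<close>, the regular space
      \<open>U \<inter> W\<close> is nonzero and so contains a nonorthogonal pair \<open>m\<close>,
      \<open>m'\<close>.\<close>
    have "\<not> U \<inter> W \<subseteq> orth (U \<inter> W)"
    proof
      assume "U \<inter> W \<subseteq> orth (U \<inter> W)"
      then have "U \<inter> W \<subseteq> {0}" using regularD[OF M(1)] by auto
      then have "dim (U \<inter> W) = 0" by simp
      then show False using M(2) k by linarith
    qed
    then obtain m m' where m: "m \<in> U \<inter> W" "m' \<in> U \<inter> W" "\<xi> m m' \<noteq> 0" by (auto simp: orth_def)
    have mp: "\<xi> p m = 0" "\<xi> q m = 0" "\<xi> p m' = 0" "\<xi> q m' = 0" "\<xi> m p = 0" "\<xi> m q = 0"
      "\<xi> m' p = 0" "\<xi> m' q = 0"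
      using S(8,9) m(1,2) form_eq_0_commute by (auto simp: orth_def)
    have mB: "m \<in> ?B" "m' \<in> ?B" using m UB by auto
    \<comment> \<open>The vectors \<open>h\<close>, \<open>h + m\<close>, \<open>h + m'\<close> have
      the same nonzero pairings with \<open>p\<close> and with \<open>q\<close>. The first is
      orthogonal to the other two, whereas these two pair to \<open>\<xi> m m'\<close>; so their
      hyperplanes form the excluded triple.\<close>
    define h where "h = p + q"
    have hB: "h \<in> ?B" "h + m \<in> ?B" "h + m' \<in> ?B" unfolding h_def using pB qB mB by (auto intro!: span_add)
    have qp: "\<xi> q p \<noteq> 0" using False form_eq_0_commute by auto
    have ph: "\<xi> p h \<noteq> 0" "\<xi> q h \<noteq> 0" "\<xi> p (h + m) \<noteq> 0" "\<xi> q (h + m) \<noteq> 0"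
       "\<xi> p (h + m') \<noteq> 0" "\<xi> q (h + m') \<noteq> 0" "\<xi> h (h + m) = 0" "\<xi> h (h + m') = 0" "\<xi> (h + m) (h + m') \<noteq> 0"
      unfolding h_def using False qp mp m(3) form_skew[of p q] by (simp_all add: form_simps)
    have h0: "h \<noteq> 0" "h + m \<noteq> 0" "h + m' \<noteq> 0" using ph(1,3,5) by auto
    let ?Y = "\<lambda>s. ?B \<inter> orth {s}"
    have Y: "?Y h \<in> tangential k" "?Y (h + m) \<in> tangential k" "?Y (h + m') \<in> tangential k"
      using regular_hyperplane[OF B] hB h0 by auto
    have "top_nbr k U W (?Y h)" "top_nbr k U W (?Y (h + m))" "top_nbr k U W (?Y (h + m'))"
      unfolding top
      using sm[OF pB p(1) hB(1) h0(1)] sm[OF pB p(1) hB(2) h0(2)] sm[OF pB p(1) hB(3) h0(3)]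
         sm[OF qB q(1) hB(1) h0(1)] sm[OF qB q(1) hB(2) h0(2)] sm[OF qB q(1) hB(3) h0(3)] ph U W by simp_all
    moreover have "\<not> smile k (?Y h) (?Y (h + m))" "\<not> smile k (?Y h) (?Y (h + m'))"
       "smile k (?Y (h + m)) (?Y (h + m'))"
      using sm[OF hB(1) h0(1) hB(2) h0(2)] sm[OF hB(1) h0(1) hB(3) h0(3)] sm[OF hB(2) h0(2) hB(3) h0(3)] ph
      by simp_all
    ultimately have "\<not> perp_smile k U W" using Y unfolding perp_smile_def by blast
    then show ?thesis using False p q by (simp add: perp_span)
  qed
qed (simp add: perp_smile_def)

definition Rad_step :: "nat \<Rightarrow> 'v set \<Rightarrow> 'v set \<Rightarrow> bool" where
  "Rad_step k X X' \<longleftrightarrow> X \<in> tangential k \<and> X' \<in> tangential k \<and>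
     (X = X' \<or> (\<exists>U\<in>tangential k. \<exists>W\<in>tangential k.
        perp_smile k U W \<and> top_nbr k U W X \<and> top_nbr k U W X' \<and> \<not> smile k X X'))"

lemma Rad_step_imp_Rad_eq:
  assumes k: "odd k" "3 \<le> k" and "Rad_step k X X'"
  shows "Rad X = Rad X'"
proof (cases "X = X'")
  case False
  then obtain U W where UW: "perp_smile k U W" "top_nbr k U W X" "top_nbr k U W X'" "\<not> smile k X X'"
    and X: "X \<in> tangential k" "X' \<in> tangential k" and tU: "U \<in> tangential k" and tW: "W \<in> tangential k"
    using assms(3) unfolding Rad_step_def by blast
  have s: "smile k U W" "perp (Rad U) (Rad W)" using UW(1) by (simp_all add: perp_smile_iff[OF k])
  obtain p where p: "p \<noteq> 0" "Rad U = span {p}" using tangentialE[OF tU] by blast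
  obtain q where q: "q \<noteq> 0" "Rad W = span {q}" using tangentialE[OF tW] by blast
  note S = smile_sum[OF k(1) s(1) p(2,1) q(2,1)]
  have "\<xi> p q = 0" using s(2) p q by (simp add: perp_span)
  then have B: "subspace (span (U \<union> W))" "dim (span (U \<union> W)) = k + 1" "rdim (span (U \<union> W)) = 2"
    using S(1,13) by auto
  show ?thesis
    using smile_in_degenerate[OF k(1) B X(1) _ X(2)] UW top_nbr_iff[OF k s(1)] by blast
qed simp

text \<open>The sum of \<open>X\<close> and \<open>X'\<close> has dimension \<open>k + 1\<close> and
  the common radical in its own radical, so it is of the degenerate type. Hyperplanes of it over two
  other points of the radical line serve as \<open>U\<close> and \<open>W\<close>.\<close>

lemma Rad_stepI:
  assumes k: "odd k" "3 \<le> k" and X: "X \<in> tangential k" and X': "X' \<in> tangential k"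
    and R: "Rad X = Rad X'" and d: "k \<le> dim (X \<inter> X') + 1"
  shows "Rad_step k X X'"
proof (cases "X = X'")
  case True
  then show ?thesis using X by (simp add: Rad_step_def)
next
  case False
  note sX = tangentialD[OF X] and sX' = tangentialD[OF X']
  have "\<not> X' \<subseteq> X"
    using False subspace_dim_equal[of X' X] sX sX' by auto
  then obtain x where x: "x \<in> X'" "x \<notin> X" by auto
  let ?B = "span (X \<union> X')"
  have x': "span (insert x (X \<inter> X')) = X'"
    using sX sX' x d by (intro span_insert_hyperplane) (auto simp: subspace_inter)
  have Beq: "?B = span (insert x X)"
  proof
    have "X' \<subseteq> span (insert x X)" by (subst x'[symmetric], rule span_mono) auto
    then show "?B \<subseteq> span (insert x X)" by (intro span_minimal) (auto intro: span_base)
    show "span (insert x X) \<subseteq> ?B" using x by (intro span_mono) auto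
  qed
  have B: "subspace ?B" "dim ?B = k + 1"
    using x sX by (simp_all add: Beq dim_insert span_of_subspace)
  have XB: "X \<subseteq> ?B" "X' \<subseteq> ?B" by (auto intro: span_base)
  obtain p where p: "p \<noteq> 0" "Rad X = span {p}" "p \<in> X" "p \<in> orth X" using tangentialE[OF X] by blast
  have "p \<in> orth X'" using p R span_base[of p "{p}"] by (auto simp: Rad_def)
  then have pR: "p \<in> Rad ?B" using p XB by (auto simp: Rad_def orth_Un)
  \<comment> \<open>The radical of \<open>?B\<close> is nonzero and of dimension at most 2; since
    \<open>k + 1\<close> is even, parity makes it a line.\<close>
  have "even (rdim ?B)" using even_dim_iff_even_rdim[OF B(1)] B(2) k by simp
  moreover have "rdim ?B \<noteq> 0" using pR p(1) by (auto simp: rdim_def)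
  moreover have "rdim ?B \<le> 2"
  proof -
    have "dim (Rad ?B) \<le> dim (Rad ?B \<inter> X) + 1"
      using sX B XB by (intro dim_le_dim_Int_hyperplane[of X ?B]) (auto simp: Rad_subset)
    moreover have "Rad ?B \<inter> X \<subseteq> Rad X" by (auto simp: Rad_def orth_Un)
    then have "dim (Rad ?B \<inter> X) \<le> 1" using dim_subset sX by metis
    ultimately show ?thesis by (simp add: rdim_def)
  qed
  ultimately have r2: "rdim ?B = 2" using le_Suc_eq by (auto simp: numeral_2_eq_2 elim!: le_SucE)
  note B = B r2
  have "\<not> Rad ?B \<subseteq> span {p}" using dim_mono[of "Rad ?B" "{p}"] r2 p by (auto simp: rdim_def)
  then obtain u where u: "u \<in> Rad ?B" "u \<notin> span {p}" by auto
  have u0: "u \<noteq> 0" using u by (auto simp: span_zero)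
  \<comment> \<open>The sum \<open>p + u\<close> spans a third point of the radical line.\<close>
  have pu: "p + u \<in> Rad ?B" using pR u B by (simp add: subspace_add)
  have pu0: "p + u \<noteq> 0"
  proof
    assume "p + u = 0"
    then have "u = - p" by (simp add: eq_neg_iff_add_eq_0 add.commute)
    then show False using u span_neg[of p "{p}"] by (simp add: span_base)
  qed
  have ne: "span {u} \<noteq> span {p}" using u span_base[of u "{u}"] by auto
  have ne1: "span {p + u} \<noteq> span {p}"
  proof
    assume "span {p + u} = span {p}"
    then have "p + u \<in> span {p}" by (metis insertI1 span_base)
    then have "(p + u) - p \<in> span {p}" by (intro span_diff) (auto intro: span_base)
    then show False using u by simp
  qed
  have ne2: "span {u} \<noteq> span {p + u}"
  proof
    assume "span {u} = span {p + u}"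
    then have "p + u \<in> span {u}" by (metis insertI1 span_base)
    then have "(p + u) - u \<in> span {u}" by (intro span_diff) (auto intro: span_base)
    then have "span {p} = span {u}" using p span_singleton_eqI[of p u] by simp
    then show False using ne by simp
  qed
  have k2: "k \<ge> 2" using k by simp
  obtain U U' where U: "U \<in> tangential k" "Rad U = span {u}" "U \<subseteq> ?B"
    "U' \<in> tangential k" "Rad U' = span {u}" "U' \<subseteq> ?B" "U \<noteq> U'"
    by (rule exists_degenerate_hyperplanes[OF B k2 u(1) u0])
  obtain W W' where W: "W \<in> tangential k" "Rad W = span {p + u}" "W \<subseteq> ?B"
    "W' \<in> tangential k" "Rad W' = span {p + u}" "W' \<subseteq> ?B" "W \<noteq> W'"
    by (rule exists_degenerate_hyperplanes[OF B k2 pu pu0])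
  note sm = smile_in_degenerate[OF k(1) B]
  have UW: "smile k U W" using sm[OF U(1,3) W(1,3)] U W ne2 by simp
  have "\<xi> u (p + u) = 0" using u pu by (auto simp: Rad_def orth_def)
  then have perp: "perp_smile k U W" using UW U W by (simp add: perp_smile_iff[OF k] perp_span)
  have "span (U \<union> W) \<subseteq> ?B" using U W by (intro span_minimal) auto
  moreover have "dim (span (U \<union> W)) = k + 1" using smile_sum(1)[OF k(1) UW U(2) u0 W(2) pu0] .
  ultimately have UWB: "span (U \<union> W) = ?B" using B by (intro subspace_dim_equal) (auto simp del: dim_span)
  have RX': "Rad X' = span {p}" using R p(2) by simp
  have sms: "smile k U X" "smile k W X" "smile k U X'" "smile k W X'" "\<not> smile k X X'"
    unfolding sm[OF U(1,3) X XB(1)] sm[OF W(1,3) X XB(1)] sm[OF U(1,3) X' XB(2)] sm[OF W(1,3) X' XB(2)]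
      sm[OF X XB(1) X' XB(2)] U(2) W(2) p(2) RX' using ne ne1 by blast+
  then have "top_nbr k U W X" "top_nbr k U W X'"
    using XB UWB by (simp_all add: top_nbr_iff[OF k UW])
  then show ?thesis using X X' U(1) W(1) perp sms(5) unfolding Rad_step_def by blast
qed


subsection \<open>Subspaces with equal radicals\<close>

text \<open>Only the hyperplane \<open>U \<inter> orth {h}\<close> of \<open>U\<close> is kept, and
  \<open>w\<close> replaces what was lost. Inside that hyperplane \<open>h\<close> is a radical
  vector; pairing with \<open>w\<close> prevents it from staying one.\<close>

lemma tangential_exchange:
  assumes U: "U \<in> tangential k" and h: "h \<in> U" and w: "w \<in> orth (Rad U)" and hw: "\<xi> h w \<noteq> 0"
  defines "U1 \<equiv> span (insert w (U \<inter> orth {h}))"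
  shows "U1 \<in> tangential k" "Rad U1 = Rad U" "k \<le> dim (U \<inter> U1) + 1"
    "w \<in> U1" "U \<inter> orth {h} \<subseteq> U1"
proof -
  let ?H = "U \<inter> orth {h}"
  note sU = tangentialD[OF U]
  obtain p where p: "p \<noteq> 0" "Rad U = span {p}" "p \<in> U" "p \<in> orth U" using tangentialE[OF U] .
  have hR: "h \<notin> Rad U" using w hw form_eq_0_commute by (auto simp: orth_def)
  then obtain a where a: "a \<in> U" "\<xi> a h \<noteq> 0"
    using h form_eq_0_commute by (auto simp: Rad_def orth_def)
  have dH: "dim ?H + 1 = k" using dim_Int_orth_singleton[OF sU(1) a] sU by simp
  have sH: "subspace ?H" using sU by (simp add: subspace_inter)
  have wh: "\<xi> w h \<noteq> 0" using hw form_eq_0_commute by blast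
  have "w \<notin> ?H" using wh by (simp add: in_orth_singleton)
  then have d1: "dim U1 = k" using dH sH by (simp add: U1_def dim_insert span_of_subspace)
  show H1: "?H \<subseteq> U1" and w1: "w \<in> U1" unfolding U1_def by (auto intro: span_base)
  have "dim ?H \<le> dim (U \<inter> U1)" using H1 by (intro dim_subset) auto
  then show "k \<le> dim (U \<inter> U1) + 1" using dH by simp
  have ph: "\<xi> p h = 0" using p h by (auto simp: orth_def)
  then have p1: "p \<in> U1" using p H1 by (auto simp: in_orth_singleton)
  have pw: "\<xi> p w = 0" using w p(2) form_eq_0_commute by (auto simp: in_orth_singleton)
  have po: "p \<in> orth U1"
    unfolding U1_def in_orth_span using p(4) pw by (auto simp: orth_def)
  have ha: "\<xi> h a \<noteq> 0" using a form_eq_0_commute by blast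
  have span: "span (insert a ?H) = U"
    using sU a dH sH by (intro span_insert_hyperplane) (auto simp: in_orth_singleton)
  have v: "v \<in> span {p}" if v: "v \<in> U1" "v \<in> orth U1" for v
  proof -
    have vH: "v \<in> orth ?H" and vw: "\<xi> v w = 0" using v(2) H1 w1 by (auto simp: orth_def)
    have hH: "h \<in> ?H" "h \<in> orth ?H" using h form_eq_0_commute by (auto simp: in_orth_singleton alternating orth_def)
    obtain c where c: "v - c *s w \<in> ?H" using v(1) sH by (auto simp: U1_def span_breakdown_eq span_of_subspace)
    have "\<xi> v h = 0" using vH hH by (auto simp: orth_def)
    moreover have "\<xi> (v - c *s w) h = 0" using c by (simp add: in_orth_singleton)
    ultimately have "c = 0" using wh by (simp add: form_simps)
    then have vU: "v \<in> ?H" using c by simp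
    \<comment> \<open>Correcting \<open>v\<close> by a multiple of \<open>h\<close> makes it
      orthogonal to \<open>a\<close> as well, hence a vector of \<open>Rad U\<close>. Pairing with
      \<open>w\<close> then shows that the multiple was 0.\<close>
    let ?v = "v - (\<xi> v a / \<xi> h a) *s h"
    have "?v \<in> orth (span (insert a ?H))"
    proof -
      have "?v \<in> orth ?H" using vH hH by (simp add: subspace_diff subspace_scale)
      moreover have "\<xi> ?v a = 0" using ha by (simp add: form_simps)
      ultimately show ?thesis unfolding in_orth_span by (auto simp: orth_def)
    qed
    moreover have "?v \<in> U" using vU h sU by (simp add: subspace_diff subspace_scale)
    ultimately have vR: "?v \<in> Rad U" using span by (simp add: Rad_def)
    then have "\<xi> ?v w = 0" using w form_eq_0_commute by (auto simp: orth_def)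
    then have "\<xi> v a / \<xi> h a = 0" using vw hw by (simp add: form_simps)
    then have "?v = v" by (simp only: scale_zero_left diff_zero)
    then show ?thesis using vR p(2) by (simp only:)
  qed
  show "U1 \<in> tangential k" "Rad U1 = Rad U"
    using tangentialI[OF _ d1 p(1) p1 po v] p(2) by (auto simp: U1_def)
qed

text \<open>As \<open>h\<close> is orthogonal to \<open>U \<inter> U'\<close>, the exchange keeps
  this whole intersection. It gains a vector \<open>w\<close> of \<open>U'\<close>, which is outside
  \<open>U\<close> because it is not orthogonal to \<open>h\<close>.\<close>

lemma Rad_step_towards:
  assumes k: "odd k" "3 \<le> k" and U: "U \<in> tangential k" and R: "Rad U = Rad U'"
    and U': "U' \<in> tangential k" and h: "h \<in> U" "h \<in> orth (U \<inter> U')" "h \<notin> orth U'"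
  obtains U1 where "Rad_step k U U1" "U1 \<in> tangential k" "Rad U1 = Rad U" "dim (U \<inter> U') < dim (U1 \<inter> U')"
proof -
  obtain w where w: "w \<in> U'" "\<xi> h w \<noteq> 0" using h(3) by (auto simp: orth_def)
  have "Rad U \<subseteq> orth U'" unfolding R by (auto simp: Rad_def)
  then have wR: "w \<in> orth (Rad U)" using w(1) subset_orth_commute[of "Rad U" U'] by blast
  let ?U1 = "span (insert w (U \<inter> orth {h}))"
  note E = tangential_exchange[OF U h(1) wR w(2)]
  have step: "Rad_step k U ?U1" using Rad_stepI[OF k U E(1) _ E(3)] E(2) by simp
  have sub: "U \<inter> U' \<subseteq> ?U1 \<inter> U'"
    using h(2) E(5) form_eq_0_commute by (auto simp: orth_def)
  have "w \<notin> U" using h(2) w by (auto simp: orth_def)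
  then have ne: "\<not> ?U1 \<inter> U' \<subseteq> U \<inter> U'" using w E(4) by auto
  have "dim (U \<inter> U') < dim (?U1 \<inter> U')"
  proof (rule ccontr)
    assume "\<not> dim (U \<inter> U') < dim (?U1 \<inter> U')"
    then have "U \<inter> U' = ?U1 \<inter> U'"
      using sub tangentialD[OF U] tangentialD[OF U'] by (intro subspace_dim_equal) (auto simp: subspace_inter)
    then show False using ne by simp
  qed
  then show thesis using that step E(1,2) by blast
qed

text \<open>If a vector \<open>h\<close> as in \<open>Rad_step_towards\<close> exists, one step
  suffices. Otherwise a first exchange, which loses nothing of the intersection, enlarges it or
  produces such a vector.\<close>

lemma Rad_step_progress:
  assumes k: "odd k" "3 \<le> k" and U: "U \<in> tangential k" and U': "U' \<in> tangential k"
    and R: "Rad U = Rad U'" and lt: "dim (U \<inter> U') < k"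
  obtains U1 U2 where "Rad_step k U U1" "Rad_step k U1 U2" "U2 \<in> tangential k" "Rad U2 = Rad U"
    "dim (U \<inter> U') < dim (U2 \<inter> U')"
proof -
  let ?D = "U \<inter> U'"
  note sU = tangentialD[OF U] and sU' = tangentialD[OF U']
  have refl: "Rad_step k V V" if "V \<in> tangential k" for V using that by (simp add: Rad_step_def)
  show thesis
  proof (cases "U \<inter> orth ?D \<subseteq> orth U'")
    case False
    then obtain h where "h \<in> U" "h \<in> orth ?D" "h \<notin> orth U'" by auto
    then show thesis using Rad_step_towards[OF k U R U'] refl that by metis
  next
    case True
    have sD: "subspace ?D" using sU sU' by (simp add: subspace_inter)
    have "Rad U \<subseteq> ?D \<inter> orth U" using R Rad_subset by (auto simp: Rad_def)
    moreover have "?D \<inter> orth U \<subseteq> Rad U" by (auto simp: Rad_def)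
    ultimately have DU: "?D \<inter> orth U = Rad U" by blast
    \<comment> \<open>Since \<open>dim ?D < k\<close>, the space \<open>U \<inter> orth ?D\<close>
      is too large to be contained in the point \<open>Rad U'\<close>. This yields an
      \<open>h\<close> outside \<open>?D\<close>.\<close>
    have "k + 1 = dim ?D + dim (U \<inter> orth ?D)" using dim_Int_orth[OF sU(1) sD] sU DU by simp
    then have d2: "dim (U \<inter> orth ?D) \<ge> 2" using lt by simp
    have "\<not> U \<inter> orth ?D \<subseteq> ?D"
    proof
      assume "U \<inter> orth ?D \<subseteq> ?D"
      then have "U \<inter> orth ?D \<subseteq> Rad U'" using True by (auto simp: Rad_def)
      then have "dim (U \<inter> orth ?D) \<le> 1" using dim_subset sU' by metis
      then show False using d2 by simp
    qed
    then obtain h where h: "h \<in> U" "h \<in> orth ?D" "h \<notin> ?D" by auto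
    have "\<not> orth ?D \<subseteq> orth {h}"
      using orth_subset_iff[OF sD, of "span {h}"] h span_base[of h "{h}"] by auto
    moreover have "\<not> orth ?D \<subseteq> orth U'"
    proof
      assume "orth ?D \<subseteq> orth U'"
      then have "U' \<subseteq> ?D" using orth_subset_iff[OF sD] sU' by simp
      then have "dim U' \<le> dim ?D" by (rule dim_subset)
      then show False using lt sU' by simp
    qed
    \<comment> \<open>This \<open>w\<close> either enlarges the intersection with \<open>U'\<close> or puts the exchanged subspace
      into the situation of the other case.\<close>
    ultimately obtain w where w: "w \<in> orth ?D" "w \<notin> orth {h}" "w \<notin> orth U'"
      by (rule subspace_not_covered_by_two[OF subspace_orth subspace_orth subspace_orth])
    have hw: "\<xi> h w \<noteq> 0" using w(2) form_eq_0_commute by (auto simp: in_orth_singleton)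
    have wR: "w \<in> orth (Rad U)" using w(1) orth_antimono[of "Rad U" ?D] DU by auto
    let ?U1 = "span (insert w (U \<inter> orth {h}))"
    note E = tangential_exchange[OF U h(1) wR hw]
    have step: "Rad_step k U ?U1" using Rad_stepI[OF k U E(1) _ E(3)] E(2) by simp
    have "?D \<subseteq> orth {h}" using h(2) subset_orth_commute[of ?D "{h}"] by simp
    then have sub: "?D \<subseteq> ?U1 \<inter> U'" using E(5) by auto
    show thesis
    proof (cases "?U1 \<inter> U' \<subseteq> ?D")
      case False
      have "dim ?D < dim (?U1 \<inter> U')"
      proof (rule ccontr)
        assume "\<not> dim ?D < dim (?U1 \<inter> U')"
        then have "?D = ?U1 \<inter> U'" using sub sD sU' by (intro subspace_dim_equal) (auto simp: subspace_inter)
        then show False using False by simp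
      qed
      then show thesis using that step refl E(1,2) by blast
    next
      case True
      then have eq: "?U1 \<inter> U' = ?D" using sub by auto
      obtain U2 where "Rad_step k ?U1 U2" "U2 \<in> tangential k" "Rad U2 = Rad ?U1"
        "dim (?U1 \<inter> U') < dim (U2 \<inter> U')"
      proof (rule Rad_step_towards[OF k E(1) _ U' E(4)])
        show "Rad ?U1 = Rad U'" using E(2) R by simp
        show "w \<in> orth (?U1 \<inter> U')" using eq w by simp
        show "w \<notin> orth U'" by fact
      qed
      then show thesis using that step E(2) eq by simp
    qed
  qed
qed

text \<open>The deficit \<open>k - dim (U \<inter> U')\<close> is at most \<open>k\<close>, and two
  steps lower it by at least one as long as it is positive. The bound does not depend on
  \<open>U\<close> and \<open>U'\<close>, which makes equality of radicals first-order.\<close>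

lemma Rad_step_chain_iff:
  assumes k: "odd k" "3 \<le> k" and U: "U \<in> tangential k" and U': "U' \<in> tangential k"
  shows "(Rad_step k ^^ (2 * k)) U U' \<longleftrightarrow> Rad U = Rad U'"
proof
  have "Rad X = Rad X'" if "(Rad_step k ^^ m) X X'" for m X X'
    using that by (induction m arbitrary: X') (auto dest: Rad_step_imp_Rad_eq[OF k])
  then show "(Rad_step k ^^ (2 * k)) U U' \<Longrightarrow> Rad U = Rad U'" .
  have "(Rad_step k ^^ (2 * j)) V U'"
    if "V \<in> tangential k" "Rad V = Rad U'" "k \<le> dim (V \<inter> U') + j" for j V
    using that
  proof (induction j arbitrary: V)
    case 0
    note s = tangentialD[OF 0(1)] and s' = tangentialD[OF U']
    have "V \<inter> U' = V" by (rule subspace_dim_equal) (use 0 s s' in \<open>auto simp: subspace_inter\<close>)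
    moreover have "V \<inter> U' = U'" by (rule subspace_dim_equal) (use 0 s s' in \<open>auto simp: subspace_inter\<close>)
    ultimately show ?case by simp
  next
    case (Suc j)
    have "\<exists>V1 V2. Rad_step k V V1 \<and> Rad_step k V1 V2 \<and> V2 \<in> tangential k \<and> Rad V2 = Rad V \<and>
        k \<le> dim (V2 \<inter> U') + j"
    proof (cases "dim (V \<inter> U') < k")
      case True
      show ?thesis
        by (rule Rad_step_progress[OF k Suc.prems(1) U' Suc.prems(2) True]) (use Suc.prems in force)
    next
      case False
      then show ?thesis using Suc.prems by (intro exI[of _ V]) (auto simp: Rad_step_def)
    qed
    then obtain V1 V2 where V: "Rad_step k V V1" "Rad_step k V1 V2" "(Rad_step k ^^ (2 * j)) V2 U'"
      using Suc by metis
    then have "(Rad_step k ^^ Suc (Suc (2 * j))) V U'" by (intro relpowp_Suc_I2)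
    then show ?case by simp
  qed
  from this[of U k] U show "Rad U = Rad U' \<Longrightarrow> (Rad_step k ^^ (2 * k)) U U'" by simp
qed

text \<open>A regular \<open>M\<close> of dimension \<open>k - 1\<close> orthogonal to
  \<open>p\<close> and \<open>q\<close> is extended by each of them. There is room for
  \<open>M\<close>: the complement of the line has dimension at least \<open>n - 2\<close> and a
  radical of dimension at most 2, where \<open>n\<close> is the dimension of the whole
  space.\<close>

lemma exists_smile_with_Rads:
  assumes k: "odd k" "k + 3 \<le> dim (UNIV :: 'v set)" and pq: "p \<noteq> 0" "q \<noteq> 0" "span {p} \<noteq> span {q}"
  obtains U W where "smile k U W" "Rad U = span {p}" "Rad W = span {q}"
proof -
  let ?S = "span {p, q}"
  have d2: "dim ?S \<le> 2" using dim_insert[of p "{q}"] pq by (simp split: if_splits)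
  have "Rad (orth ?S) \<subseteq> ?S" using orth_orth[of ?S] by (auto simp: Rad_def)
  then have "rdim (orth ?S) \<le> 2" unfolding rdim_def using d2 dim_subset le_trans by blast
  moreover have "dim (UNIV :: 'v set) \<le> dim (orth ?S) + 2" using dim_orth[of ?S] d2 subspace_span by (simp del: dim_UNIV dim_span orth_span)
  ultimately have "2 * ((k - 1) div 2) + rdim (orth ?S) \<le> dim (orth ?S)" using k by (auto elim!: oddE)
  then obtain M where M: "regular M" "M \<subseteq> orth ?S" "dim M = 2 * ((k - 1) div 2)"
    using exists_regular_subspace[OF subspace_orth] by blast
  have dM: "dim M + 1 = k" using M(3) k by (auto elim!: oddE)
  have "?S \<subseteq> orth M" using M(2) subset_orth_commute by blast
  then have po: "p \<in> orth M" "q \<in> orth M" by (auto intro: span_base)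
  show thesis
    using that[OF smile_insert[OF k(1) M(1) dM pq(1,2) po pq(3)]]
      tangential_insert(2)[OF M(1) po(1) pq(1)] tangential_insert(2)[OF M(1) po(2) pq(2)] by blast
qed

text \<open>Neighbours have different radicals, so equal radicals need the first disjunct. Different
  ones are moved along chains to a pair of neighbours, supplied by
  \<open>exists_smile_with_Rads\<close>.\<close>

lemma perp_Rad_iff_perp_smile:
  assumes k: "odd k" "3 \<le> k" "k + 3 \<le> dim (UNIV :: 'v set)"
    and U: "U \<in> tangential k" and W: "W \<in> tangential k"
  shows "perp (Rad U) (Rad W) \<longleftrightarrow> (Rad_step k ^^ (2 * k)) U W \<or>
    (\<exists>U'\<in>tangential k. \<exists>W'\<in>tangential k. (Rad_step k ^^ (2 * k)) U U' \<and>
       (Rad_step k ^^ (2 * k)) W W' \<and> perp_smile k U' W')"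
proof -
  obtain p where p: "p \<noteq> 0" "Rad U = span {p}" using tangentialE[OF U] by blast
  obtain q where q: "q \<noteq> 0" "Rad W = span {q}" using tangentialE[OF W] by blast
  note same = Rad_step_chain_iff[OF k(1,2)]
  show ?thesis
  proof
    assume perp: "perp (Rad U) (Rad W)"
    show "(Rad_step k ^^ (2 * k)) U W \<or>
    (\<exists>U'\<in>tangential k. \<exists>W'\<in>tangential k. (Rad_step k ^^ (2 * k)) U U' \<and>
       (Rad_step k ^^ (2 * k)) W W' \<and> perp_smile k U' W')"
    proof (cases "Rad U = Rad W")
      case True
      then show ?thesis using same[OF U W] by simp
    next
      case False
      then obtain U' W' where s: "smile k U' W'" "Rad U' = span {p}" "Rad W' = span {q}"
        using exists_smile_with_Rads[OF k(1,3) p(1) q(1)] p q by auto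
      then have t: "U' \<in> tangential k" "W' \<in> tangential k" by (auto simp: smile_def)
      have "perp_smile k U' W'" using s perp p q by (simp add: perp_smile_iff[OF k(1,2)])
      then show ?thesis using same[OF U t(1)] same[OF W t(2)] s p q t by auto
    qed
  next
    assume "(Rad_step k ^^ (2 * k)) U W \<or>
    (\<exists>U'\<in>tangential k. \<exists>W'\<in>tangential k. (Rad_step k ^^ (2 * k)) U U' \<and>
       (Rad_step k ^^ (2 * k)) W W' \<and> perp_smile k U' W')"
    then show "perp (Rad U) (Rad W)"
    proof
      assume "(Rad_step k ^^ (2 * k)) U W"
      then have "Rad U = Rad W" using same U W by blast
      then show ?thesis by (auto simp: perp_iff Rad_def orth_def)
    next
      assume "\<exists>U'\<in>tangential k. \<exists>W'\<in>tangential k. (Rad_step k ^^ (2 * k)) U U' \<and>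
       (Rad_step k ^^ (2 * k)) W W' \<and> perp_smile k U' W'"
      then show ?thesis using same U W by (auto simp: perp_smile_iff[OF k(1,2)])
    qed
  qed
qed

text \<open>The radicals of those \<open>X\<close> run through the points of \<open>orth W\<close>
  other than \<open>Rad W\<close>: such a point, joined to a regular hyperplane of \<open>W\<close>,
  is a neighbour of \<open>W\<close>. So the right-hand side says that \<open>Rad U\<close> is
  orthogonal to \<open>orth W\<close>.\<close>

lemma Rad_subset_iff:
  assumes k: "odd k" and U: "U \<in> tangential k" and W: "W \<in> tangential k"
  shows "Rad U \<subseteq> W \<longleftrightarrow> perp (Rad U) (Rad W) \<and>
    (\<forall>X\<in>tangential k. smile k W X \<and> perp (Rad X) (Rad W) \<longrightarrow> perp (Rad U) (Rad X))"
proof -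
  obtain q where q: "q \<noteq> 0" "Rad W = span {q}" "q \<in> W" "q \<in> orth W" using tangentialE[OF W] by blast
  note sW = tangentialD[OF W]
  show ?thesis
  proof (intro iffI conjI ballI impI)
    assume UW: "Rad U \<subseteq> W"
    have "Rad W \<subseteq> orth W" by (auto simp: Rad_def)
    then show "perp (Rad U) (Rad W)"
      using UW subset_orth_commute[of "Rad W" W] unfolding perp_iff by blast
    fix X assume X: "X \<in> tangential k" and sX: "smile k W X \<and> perp (Rad X) (Rad W)"
    have "Rad X \<subseteq> orth W"
    proof -
      have M: "regular (W \<inter> X)" "dim (W \<inter> X) + 1 = k" using sX k by (auto simp: smile_iff)
      have W': "W \<in> tangential (dim (W \<inter> X) + 1)" using W M by simp
      note W'' = tangential_eq_insert(1)[OF M(1) Int_lower1 W' q(2,1)]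
      have "Rad X \<subseteq> orth X" by (auto simp: Rad_def)
      then have "Rad X \<subseteq> orth (W \<inter> X)" using orth_antimono[of "W \<inter> X" X] by auto
      moreover have "Rad X \<subseteq> orth {q}" using sX q by (simp add: perp_iff)
      ultimately have "Rad X \<subseteq> orth (span (insert q (W \<inter> X)))" unfolding orth_span orth_insert[of q "W \<inter> X"] by blast
      then show ?thesis using W'' by simp
    qed
    then show "perp (Rad U) (Rad X)" using UW subset_orth_commute[of "Rad X" W] unfolding perp_iff by blast
  next
    assume *: "perp (Rad U) (Rad W) \<and>
      (\<forall>X\<in>tangential k. smile k W X \<and> perp (Rad X) (Rad W) \<longrightarrow> perp (Rad U) (Rad X))"
    obtain M where M: "regular M" "M \<subseteq> W" "dim M + 1 = k" using tangential_complement[OF k W] .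
    have W': "W \<in> tangential (dim M + 1)" using W M by simp
    note W'' = tangential_eq_insert[OF M(1,2) W' q(2,1)]
    have "Rad U \<subseteq> orth {r}" if r: "r \<in> orth W" for r
    proof (cases "r \<in> span {q}")
      case True
      have "Rad U \<subseteq> orth (span {q})" using * q by (simp add: perp_iff)
      also have "\<dots> \<subseteq> orth {r}" using True by (intro orth_antimono) auto
      finally show ?thesis .
    next
      case False
      have r0: "r \<noteq> 0" using False by (auto simp: span_zero)
      have rM: "r \<in> orth M" using r orth_antimono[OF M(2)] by auto
      have ne: "span {q} \<noteq> span {r}" using False span_base[of r "{r}"] by auto
      let ?X = "span (insert r M)"
      have X: "?X \<in> tangential k" "Rad ?X = span {r}"
        using tangential_insert[OF M(1) rM r0] M(3) by auto
      have "smile k W ?X"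
        using smile_insert[OF k M(1,3) q(1) r0 W''(2) rM ne] W''(1) by simp
      moreover have "perp (Rad ?X) (Rad W)" using X q r by (auto simp: perp_span orth_def)
      ultimately have "perp (Rad U) (span {r})" using * X by metis
      then show ?thesis by (simp add: perp_iff)
    qed
    then have "Rad U \<subseteq> orth (orth W)" by (auto simp: orth_def)
    then show "Rad U \<subseteq> W" using orth_orth sW by simp
  qed
qed

text \<open>Here the whole space is itself the regular \<open>(k + 1)\<close>-space containing
  \<open>U\<close> and \<open>W\<close>.\<close>

lemma perp_Rad_iff_not_smile:
  assumes k: "odd k" "k + 1 = dim (UNIV :: 'v set)" and U: "U \<in> tangential k" and W: "W \<in> tangential k"
  shows "perp (Rad U) (Rad W) \<longleftrightarrow> \<not> smile k U W"
proof -
  obtain p where p: "p \<noteq> 0" "Rad U = span {p}" using tangentialE[OF U] by blast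
  obtain q where q: "q \<noteq> 0" "Rad W = span {q}" using tangentialE[OF W] by blast
  have B: "dim (UNIV :: 'v set) = k + 1" using k by (simp del: dim_UNIV)
  have "smile k (UNIV \<inter> orth {p}) (UNIV \<inter> orth {q}) \<longleftrightarrow> \<xi> p q \<noteq> 0"
    by (rule smile_in_regular[OF k(1) regular_UNIV B]) (use p q in auto)
  moreover have "U = UNIV \<inter> orth {p}" "W = UNIV \<inter> orth {q}"
    using tangential_in_regular[OF regular_UNIV B U _ p(2,1)] tangential_in_regular[OF regular_UNIV B W _ q(2,1)] by auto
  ultimately show ?thesis using p q by (simp add: perp_span)
qed

subsection \<open>Points as radicals and duality\<close>

lemma points_iff: "P \<in> points \<longleftrightarrow> (\<exists>p. p \<noteq> 0 \<and> P = span {p})"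
proof
  show "P \<in> points \<Longrightarrow> \<exists>p. p \<noteq> 0 \<and> P = span {p}"
    using dim_eq_1_E by (auto simp: points_def)
qed (auto simp: points_def)

lemma Rad_tangential_point: "U \<in> tangential k \<Longrightarrow> Rad U \<in> points"
  using tangentialD[of U k] by (simp add: points_def)

lemma point_eq_Rad:
  assumes k: "odd k" "k + 1 \<le> dim (UNIV :: 'v set)" and P: "P \<in> points"
  obtains U where "U \<in> tangential k" "Rad U = P"
proof -
  obtain p where p: "p \<noteq> 0" "P = span {p}" using P by (auto simp: points_iff)
  \<comment> \<open>The vector \<open>q\<close> completes \<open>p\<close> to a hyperbolic plane.
    Its complement is regular of dimension at least \<open>k - 1\<close>, and it contains the
    regular \<open>M\<close> to which \<open>p\<close> is added.\<close>
  obtain q where q: "\<xi> p q \<noteq> 0" using nondegenerate p by blast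
  have "regular {0}" by (intro regularI) auto
  moreover have o0: "orth {0} = UNIV" by (auto simp: orth_def)
  ultimately have reg: "regular (span (insert p (insert q {0})))" "dim (span (insert p (insert q {0}))) = 2"
    using regular_insert_insert[of "{0}" p q] q by (auto simp: dim_insert)
  let ?S = "span (insert p (insert q {0}))"
  have d: "dim (orth ?S) + 2 = dim (UNIV :: 'v set)"
    using dim_orth[of ?S] reg(2) by simp
  have "Rad (orth ?S) = Rad ?S" using orth_orth[of ?S] by (auto simp: Rad_def)
  then have "rdim (orth ?S) = 0" using reg(1) by (simp add: rdim_def regular_def)
  then have "2 * ((k - 1) div 2) + rdim (orth ?S) \<le> dim (orth ?S)" using k d by (auto elim!: oddE)
  then obtain M where M: "regular M" "M \<subseteq> orth ?S" "dim M = 2 * ((k - 1) div 2)"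
    using exists_regular_subspace[OF subspace_orth] by blast
  have dM: "dim M + 1 = k" using M(3) k by (auto elim!: oddE)
  have "p \<in> orth M" using M(2) subset_orth_commute[of M ?S] span_base[of p "insert p (insert q {0})"] by blast
  then show thesis using that tangential_insert[OF M(1) _ p(1)] dM p(2) by auto
qed

lemma orth_tangential:
  assumes U: "U \<in> tangential k"
  shows "orth U \<in> tangential (dim (UNIV :: 'v set) - k)" "Rad (orth U) = Rad U"
proof -
  note s = tangentialD[OF U]
  show R: "Rad (orth U) = Rad U" using orth_orth[OF s(1)] by (auto simp: Rad_def)
  show "orth U \<in> tangential (dim (UNIV :: 'v set) - k)"
    using dim_orth[OF s(1)] s R unfolding tangential_def rdim_def by (auto simp del: dim_UNIV)
qed

lemma regular_orth: "subspace B \<Longrightarrow> regular (orth B) \<longleftrightarrow> regular B"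
  using orth_orth[of B] by (auto simp: regular_def Rad_def Int_commute)

lemma bij_betw_orth_tangential:
  assumes "k \<le> dim (UNIV :: 'v set)"
  shows "bij_betw orth (tangential k) (tangential (dim (UNIV :: 'v set) - k))"
  by (rule bij_betw_byWitness[where f' = orth])
    (use orth_tangential(1)[of _ k] orth_tangential(1)[of _ "dim (UNIV :: 'v set) - k"] assms tangentialD(1)
      orth_orth in \<open>auto simp del: dim_UNIV\<close>)

lemma even_dim_UNIV: "even (dim (UNIV :: 'v set))"
  using even_dim_iff_even_rdim[of UNIV] regular_iff_rdim[of UNIV] regular_UNIV by (simp del: dim_UNIV)

text \<open>The complements intersect in \<open>orth (span (U \<union> W))\<close>, so their
  adjacency means that the sum is regular of dimension \<open>k + 1\<close>. Any
  \<open>(k + 1)\<close>-space containing two different \<open>k\<close>-spaces equals their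
  sum.\<close>

lemma frown_iff_smile_orth:
  assumes k: "odd k" "k + 1 \<le> dim (UNIV :: 'v set)"
    and U: "U \<in> tangential k" and W: "W \<in> tangential k"
  shows "frown k U W \<longleftrightarrow> smile (dim (UNIV :: 'v set) - k) (orth U) (orth W)"
proof -
  let ?n = "dim (UNIV :: 'v set)" and ?B = "span (U \<union> W)"
  note sU = tangentialD[OF U] and sW = tangentialD[OF W]
  have en: "even ?n"
    by (rule even_dim_UNIV)
  have ok: "odd (?n - k)" using en k by simp
  have oB: "orth U \<inter> orth W = orth ?B" by (simp add: orth_Un)
  have dB: "dim ?B + dim (orth ?B) = ?n" by (rule dim_orth) simp
  have "smile (?n - k) (orth U) (orth W) \<longleftrightarrow> regular ?B \<and> dim ?B = k + 1"
    unfolding smile_iff[OF ok] oB regular_orth[OF subspace_span]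
    using orth_tangential(1)[OF U] orth_tangential(1)[OF W] dB k by (auto simp del: dim_UNIV dim_span orth_span)
  also have "\<dots> \<longleftrightarrow> frown k U W"
  proof
    assume B: "regular ?B \<and> dim ?B = k + 1"
    then have "U \<noteq> W" using sU by (auto simp: span_of_subspace)
    then show "frown k U W" using B U W k unfolding frown_def
      by (auto simp: TR_even intro!: bexI[of _ ?B] span_base)
  next
    assume fr: "frown k U W"
    then have ne: "U \<noteq> W" by (simp add: frown_def)
    from fr obtain B where B: "regular B" "dim B = k + 1" "U \<subseteq> B" "W \<subseteq> B"
      using k TR_even[of "k + 1"] by (auto simp: frown_def)
    have BB: "?B \<subseteq> B" using B regular_subspace by (intro span_minimal) auto
    have "\<not> W \<subseteq> U" using subspace_dim_equal[of W U] sU sW ne by auto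
    then obtain w where w: "w \<in> W" "w \<notin> U" by auto
    have "dim (insert w U) = k + 1" using w sU by (simp add: dim_insert span_of_subspace)
    moreover have "dim (insert w U) \<le> dim ?B" using w by (intro dim_subset) (auto intro: span_base)
    ultimately have "?B = B" using BB B regular_subspace by (intro subspace_dim_equal) auto
    then show "regular ?B \<and> dim ?B = k + 1" using B by simp
  qed
  finally show ?thesis by simp
qed

end

subsection \<open>Definability of predicates on assignments\<close>

text \<open>Predicates on assignments replace sets of lists, so that definability follows from
  closure rules for the connectives and formulas need not be written out.\<close>

definition env_definable ::
    "'s set \<Rightarrow> ('s \<Rightarrow> 's \<Rightarrow> bool) \<Rightarrow> ((nat \<Rightarrow> 's) \<Rightarrow> bool) \<Rightarrow> bool" where
  "env_definable A E P \<longleftrightarrow> (\<exists>\<phi>. \<forall>e. range e \<subseteq> A \<longrightarrow> (fo_sat A E e \<phi> \<longleftrightarrow> P e))"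

lemma fo_definable_iff_env_definable:
  "fo_definable A E m S \<longleftrightarrow> env_definable A E (\<lambda>e. map e [0..<m] \<in> S)"
  by (simp add: fo_definable_def env_definable_def)

lemma env_definable_cong:
  assumes "env_definable A E P" "\<And>e. range e \<subseteq> A \<Longrightarrow> P e \<longleftrightarrow> Q e"
  shows "env_definable A E Q"
  using assms unfolding env_definable_def by blast

lemma env_definable_rel: "env_definable A E (\<lambda>e. E (e i) (e j))"
  unfolding env_definable_def by (rule exI[of _ "Rel i j"]) simp

lemma env_definable_eq: "env_definable A E (\<lambda>e. e i = e j)"
  unfolding env_definable_def by (rule exI[of _ "Eq i j"]) simp

lemma env_definable_neg:
  assumes "env_definable A E P"
  shows "env_definable A E (\<lambda>e. \<not> P e)"
proof -
  obtain \<phi> where "\<forall>e. range e \<subseteq> A \<longrightarrow> (fo_sat A E e \<phi> \<longleftrightarrow> P e)"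
    using assms unfolding env_definable_def by blast
  then show ?thesis unfolding env_definable_def by (intro exI[of _ "Neg \<phi>"]) simp
qed

lemma env_definable_conj:
  assumes "env_definable A E P" "env_definable A E Q"
  shows "env_definable A E (\<lambda>e. P e \<and> Q e)"
proof -
  obtain \<phi> \<psi> where "\<forall>e. range e \<subseteq> A \<longrightarrow> (fo_sat A E e \<phi> \<longleftrightarrow> P e)"
    "\<forall>e. range e \<subseteq> A \<longrightarrow> (fo_sat A E e \<psi> \<longleftrightarrow> Q e)"
    using assms unfolding env_definable_def by blast
  then show ?thesis unfolding env_definable_def by (intro exI[of _ "Conj \<phi> \<psi>"]) simp
qed

lemma env_definable_disj:
  assumes "env_definable A E P" "env_definable A E Q"
  shows "env_definable A E (\<lambda>e. P e \<or> Q e)"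
proof -
  have "env_definable A E (\<lambda>e. \<not> (\<not> P e \<and> \<not> Q e))"
    by (intro env_definable_neg env_definable_conj assms)
  then show ?thesis by (rule env_definable_cong) blast
qed

lemma env_definable_imp:
  assumes "env_definable A E P" "env_definable A E Q"
  shows "env_definable A E (\<lambda>e. P e \<longrightarrow> Q e)"
  by (rule env_definable_cong[OF env_definable_disj[OF env_definable_neg[OF assms(1)] assms(2)]]) blast

text \<open>The quantified variable \<open>i\<close> has to be fresh, i.e. \<open>P\<close> must not depend on the value of \<open>i\<close>.\<close>

lemma env_definable_bex:
  assumes "env_definable A E (\<lambda>e. P e (e i))" "\<And>e a x. P (e(i := a)) x \<longleftrightarrow> P e x"
  shows "env_definable A E (\<lambda>e. \<exists>x\<in>A. P e x)"
proof -
  obtain \<phi> where \<phi>: "\<And>e. range e \<subseteq> A \<Longrightarrow> fo_sat A E e \<phi> \<longleftrightarrow> P e (e i)"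
    using assms(1) unfolding env_definable_def by blast
  have "fo_sat A E e (Ex i \<phi>) \<longleftrightarrow> (\<exists>x\<in>A. P e x)" if "range e \<subseteq> A" for e
  proof -
    have "fo_sat A E (e(i := a)) \<phi> \<longleftrightarrow> P e a" if "a \<in> A" for a
      using \<phi>[of "e(i := a)"] \<open>range e \<subseteq> A\<close> that assms(2) by auto
    then show ?thesis by auto
  qed
  then show ?thesis unfolding env_definable_def by blast
qed

lemma env_definable_ball:
  assumes "env_definable A E (\<lambda>e. P e (e i))" "\<And>e a x. P (e(i := a)) x \<longleftrightarrow> P e x"
  shows "env_definable A E (\<lambda>e. \<forall>x\<in>A. P e x)"
proof -
  have "env_definable A E (\<lambda>e. \<exists>x\<in>A. \<not> P e x)"
    using env_definable_bex[of A E "\<lambda>e x. \<not> P e x" i] env_definable_neg[OF assms(1)] assms(2) by simp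
  from env_definable_neg[OF this] show ?thesis by simp
qed

lemmas env_definable_intros = env_definable_neg env_definable_conj env_definable_disj env_definable_imp

lemma fresh_variable: "finite S \<Longrightarrow> \<exists>a :: nat. a \<notin> S"
  by (rule ex_new_if_finite) (rule infinite_UNIV_nat)

lemma fo_sat_iso:
  assumes "bij_betw g A A'" "\<And>x y. x \<in> A \<Longrightarrow> y \<in> A \<Longrightarrow> E' (g x) (g y) \<longleftrightarrow> E x y" "range e \<subseteq> A"
  shows "fo_sat A' E' (g \<circ> e) \<phi> \<longleftrightarrow> fo_sat A E e \<phi>"
  using assms(3)
proof (induction \<phi> arbitrary: e)
  case (Rel i j)
  then show ?case using assms(2)[of "e i" "e j"] by auto
next
  case (Eq i j)
  then have "e i \<in> A" "e j \<in> A" by auto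
  then show ?case using assms(1) by (auto simp: bij_betw_def inj_on_def)
next
  case (Ex i \<phi>)
  have upd: "(g \<circ> e)(i := g a) = g \<circ> e(i := a)" for a by auto
  have "A' = g ` A" using assms(1) by (simp add: bij_betw_def)
  then have "fo_sat A' E' (g \<circ> e) (Ex i \<phi>) \<longleftrightarrow> (\<exists>a\<in>A. fo_sat A' E' (g \<circ> e(i := a)) \<phi>)"
    by (simp add: upd)
  also have "\<dots> \<longleftrightarrow> (\<exists>a\<in>A. fo_sat A E (e(i := a)) \<phi>)"
  proof (rule bex_cong[OF refl])
    fix a assume "a \<in> A"
    then have "range (e(i := a)) \<subseteq> A" using Ex.prems by auto
    then show "fo_sat A' E' (g \<circ> e(i := a)) \<phi> \<longleftrightarrow> fo_sat A E (e(i := a)) \<phi>" by (rule Ex.IH)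
  qed
  also have "\<dots> \<longleftrightarrow> fo_sat A E e (Ex i \<phi>)" by simp
  finally show ?case .
qed auto

text \<open>Needed for \<open>g = orth\<close>, to carry definitions for \<open>smile\<close> over
  to \<open>frown\<close>.\<close>

lemma env_definable_iso:
  assumes "bij_betw g A A'" "\<And>x y. x \<in> A \<Longrightarrow> y \<in> A \<Longrightarrow> E' (g x) (g y) \<longleftrightarrow> E x y"
    and "env_definable A' E' P"
  shows "env_definable A E (\<lambda>e. P (g \<circ> e))"
proof -
  obtain \<phi> where \<phi>: "\<And>e. range e \<subseteq> A' \<Longrightarrow> fo_sat A' E' e \<phi> \<longleftrightarrow> P e"
    using assms(3) unfolding env_definable_def by blast
  have "fo_sat A E e \<phi> \<longleftrightarrow> P (g \<circ> e)" if e: "range e \<subseteq> A" for e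
  proof -
    have "range (g \<circ> e) \<subseteq> A'" using e bij_betwE[OF assms(1)] by auto
    then show ?thesis using \<phi>[of "g \<circ> e"] fo_sat_iso[of g A A' E' E, OF assms(1,2) e, of \<phi>] by blast
  qed
  then show ?thesis unfolding env_definable_def by blast
qed

text \<open>Truth of a formula is invariant under automorphisms; this is how definability yields the
  statement on bijections.\<close>

lemma env_definable_automorphism:
  assumes "env_definable A E P" "bij_betw f A A" "preserves A E f" "range e \<subseteq> A"
  shows "P (f \<circ> e) \<longleftrightarrow> P e"
proof -
  obtain \<phi> where \<phi>: "\<And>e. range e \<subseteq> A \<Longrightarrow> fo_sat A E e \<phi> \<longleftrightarrow> P e"
    using assms(1) unfolding env_definable_def by blast
  have "range (f \<circ> e) \<subseteq> A" using assms(4) bij_betwE[OF assms(2)] by auto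
  moreover have "fo_sat A E (f \<circ> e) \<phi> \<longleftrightarrow> fo_sat A E e \<phi>"
    using assms(2-4) by (intro fo_sat_iso) (auto simp: preserves_def)
  ultimately show ?thesis using \<phi> assms(4) by blast
qed

context symplectic_space
begin

subsection \<open>Defining the projective space\<close>

lemma smile_definable: "env_definable (tangential k) (smile k) (\<lambda>e. smile k (e i) (e j))"
  by (rule env_definable_rel)

lemma common_nbrs_clique_definable:
  "env_definable (tangential k) (smile k) (\<lambda>e. common_nbrs_clique k (e i) (e j) (e l))"
proof -
  obtain a where a: "a \<notin> {i, j, l}" using fresh_variable[of "{i, j, l}"] by auto
  obtain b where b: "b \<notin> {i, j, l, a}" using fresh_variable[of "{i, j, l, a}"] by auto
  show ?thesis
    unfolding common_nbrs_clique_def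
    by (rule env_definable_ball[where i = a], rule env_definable_ball[where i = b],
        intro env_definable_intros smile_definable env_definable_eq) (use a b in simp_all)
qed

lemma top_nbr_definable:
  "env_definable (tangential k) (smile k) (\<lambda>e. top_nbr k (e i) (e j) (e l))"
  unfolding top_nbr_def
  by (intro env_definable_intros smile_definable common_nbrs_clique_definable)

lemma perp_smile_definable:
  "env_definable (tangential k) (smile k) (\<lambda>e. perp_smile k (e i) (e j))"
proof -
  define a where "a = Suc (i + j)"
  define b where "b = Suc a"
  define c where "c = Suc b"
  have a: "i \<noteq> a" "j \<noteq> a" and b: "i \<noteq> b" "j \<noteq> b" "a \<noteq> b"
    and c: "i \<noteq> c" "j \<noteq> c" "a \<noteq> c" "b \<noteq> c"
    unfolding a_def b_def c_def by presburger+
  have "env_definable (tangential k) (smile k) (\<lambda>e. \<exists>X\<in>tangential k. \<exists>Y\<in>tangential k. \<exists>Y'\<in>tangential k.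
         top_nbr k (e i) (e j) X \<and> top_nbr k (e i) (e j) Y \<and> top_nbr k (e i) (e j) Y' \<and>
         \<not> smile k X Y \<and> \<not> smile k X Y' \<and> smile k Y Y')"
    by (rule env_definable_bex[where i = a], rule env_definable_bex[where i = b],
        rule env_definable_bex[where i = c],
        intro env_definable_intros smile_definable top_nbr_definable) (simp_all only: fun_upd_other[OF a(1)] fun_upd_other[OF a(2)]
          fun_upd_other[OF b(1)] fun_upd_other[OF b(2)] fun_upd_other[OF b(3)]
          fun_upd_other[OF c(1)] fun_upd_other[OF c(2)] fun_upd_other[OF c(3)] fun_upd_other[OF c(4)])
  then show ?thesis
    unfolding perp_smile_def by (intro env_definable_intros smile_definable)
qed

lemma Rad_step_definable:
  "env_definable (tangential k) (smile k) (\<lambda>e. Rad_step k (e i) (e j))"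
proof -
  obtain a where a: "a \<notin> {i, j}" using fresh_variable[of "{i, j}"] by auto
  obtain b where b: "b \<notin> {i, j, a}" using fresh_variable[of "{i, j, a}"] by auto
  have "env_definable (tangential k) (smile k) (\<lambda>e. \<exists>U\<in>tangential k. \<exists>W\<in>tangential k.
        perp_smile k U W \<and> top_nbr k U W (e i) \<and> top_nbr k U W (e j) \<and> \<not> smile k (e i) (e j))"
    by (rule env_definable_bex[where i = a], rule env_definable_bex[where i = b],
        intro env_definable_intros smile_definable top_nbr_definable perp_smile_definable) (use a b in simp_all)
  then have "env_definable (tangential k) (smile k) (\<lambda>e. e i = e j \<or> (\<exists>U\<in>tangential k. \<exists>W\<in>tangential k.
        perp_smile k U W \<and> top_nbr k U W (e i) \<and> top_nbr k U W (e j) \<and> \<not> smile k (e i) (e j)))"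
    by (intro env_definable_disj env_definable_eq)
  then show ?thesis
    by (rule env_definable_cong) (auto simp: Rad_step_def)
qed

lemma Rad_step_tangential: "Rad_step k X Y \<Longrightarrow> X \<in> tangential k \<and> Y \<in> tangential k"
  by (simp add: Rad_step_def)

text \<open>The exponent is a fixed number, so the chain unfolds into finitely many quantifiers. Its
  intermediate members are in the domain by \<open>Rad_step_tangential\<close>.\<close>

lemma Rad_step_chain_definable:
  "env_definable (tangential k) (smile k) (\<lambda>e. (Rad_step k ^^ m) (e i) (e j))"
proof (induction m arbitrary: j)
  case 0
  then show ?case by (simp add: env_definable_eq)
next
  case (Suc m)
  obtain a where a: "a \<notin> {i, j}" using fresh_variable[of "{i, j}"] by auto
  have "env_definable (tangential k) (smile k)
      (\<lambda>e. \<exists>X\<in>tangential k. (Rad_step k ^^ m) (e i) X \<and> Rad_step k X (e j))"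
    by (rule env_definable_bex[where i = a],
        intro env_definable_intros Suc.IH Rad_step_definable) (use a in simp_all)
  then show ?case
    by (rule env_definable_cong) (auto simp: relcompp_apply dest: Rad_step_tangential)
qed

text \<open>The dimension of the space is even and \<open>k\<close> is odd, so if
  \<open>k + 3\<close> exceeds the dimension, only hyperplanes remain; there orthogonality of
  radicals is nonadjacency.\<close>

lemma perp_Rad_definable_smile:
  assumes k: "odd k" "3 \<le> k" "k + 1 \<le> dim (UNIV :: 'v set)"
  shows "env_definable (tangential k) (smile k) (\<lambda>e. perp (Rad (e i)) (Rad (e j)))"
proof (cases "k + 3 \<le> dim (UNIV :: 'v set)")
  case True
  obtain a where a: "a \<notin> {i, j}" using fresh_variable[of "{i, j}"] by auto
  obtain b where b: "b \<notin> {i, j, a}" using fresh_variable[of "{i, j, a}"] by auto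
  have "env_definable (tangential k) (smile k) (\<lambda>e. \<exists>U\<in>tangential k. \<exists>W\<in>tangential k.
       (Rad_step k ^^ (2 * k)) (e i) U \<and> (Rad_step k ^^ (2 * k)) (e j) W \<and> perp_smile k U W)"
    by (rule env_definable_bex[where i = a], rule env_definable_bex[where i = b],
        intro env_definable_intros Rad_step_chain_definable perp_smile_definable) (use a b in simp_all)
  then have "env_definable (tangential k) (smile k) (\<lambda>e. (Rad_step k ^^ (2 * k)) (e i) (e j) \<or>
      (\<exists>U\<in>tangential k. \<exists>W\<in>tangential k.
       (Rad_step k ^^ (2 * k)) (e i) U \<and> (Rad_step k ^^ (2 * k)) (e j) W \<and> perp_smile k U W))"
    by (intro env_definable_disj Rad_step_chain_definable)
  then show ?thesis
  proof (rule env_definable_cong)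
    fix e :: "nat \<Rightarrow> 'v set" assume "range e \<subseteq> tangential k"
    then have "e i \<in> tangential k" "e j \<in> tangential k" by auto
    from perp_Rad_iff_perp_smile[OF k(1,2) True this]
    show "((Rad_step k ^^ (2 * k)) (e i) (e j) \<or>
      (\<exists>U\<in>tangential k. \<exists>W\<in>tangential k.
       (Rad_step k ^^ (2 * k)) (e i) U \<and> (Rad_step k ^^ (2 * k)) (e j) W \<and> perp_smile k U W)) \<longleftrightarrow>
       perp (Rad (e i)) (Rad (e j))" by blast
  qed
next
  case False
  have "n < k + 3 \<Longrightarrow> k + 1 \<le> n \<Longrightarrow> even n \<Longrightarrow> k + 1 = n" for n
    using k(1) by presburger
  then have kn: "k + 1 = dim (UNIV :: 'v set)" using even_dim_UNIV False k(3) by (meson not_le)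
  have "env_definable (tangential k) (smile k) (\<lambda>e. \<not> smile k (e i) (e j))"
    by (intro env_definable_neg smile_definable)
  then show ?thesis
  proof (rule env_definable_cong)
    fix e :: "nat \<Rightarrow> 'v set" assume "range e \<subseteq> tangential k"
    then have "e i \<in> tangential k" "e j \<in> tangential k" by auto
    from perp_Rad_iff_not_smile[OF k(1) kn this]
    show "\<not> smile k (e i) (e j) \<longleftrightarrow> perp (Rad (e i)) (Rad (e j))" by simp
  qed
qed

lemma Rad_subset_definable_smile:
  assumes k: "odd k" "3 \<le> k" "k + 1 \<le> dim (UNIV :: 'v set)"
  shows "env_definable (tangential k) (smile k) (\<lambda>e. Rad (e i) \<subseteq> e j)"
proof -
  note perp_Rad = perp_Rad_definable_smile[OF k]
  obtain a where a: "a \<notin> {i, j}" using fresh_variable[of "{i, j}"] by auto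
  have "env_definable (tangential k) (smile k) (\<lambda>e. \<forall>X\<in>tangential k.
      smile k (e j) X \<and> perp (Rad X) (Rad (e j)) \<longrightarrow> perp (Rad (e i)) (Rad X))"
    by (rule env_definable_ball[where i = a],
        intro env_definable_intros smile_definable perp_Rad) (use a in simp_all)
  then have "env_definable (tangential k) (smile k) (\<lambda>e. perp (Rad (e i)) (Rad (e j)) \<and> (\<forall>X\<in>tangential k.
      smile k (e j) X \<and> perp (Rad X) (Rad (e j)) \<longrightarrow> perp (Rad (e i)) (Rad X)))"
    by (intro env_definable_conj perp_Rad)
  then show ?thesis
  proof (rule env_definable_cong)
    fix e :: "nat \<Rightarrow> 'v set" assume "range e \<subseteq> tangential k"
    then have "e i \<in> tangential k" "e j \<in> tangential k" by auto
    from Rad_subset_iff[OF k(1) this]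
    show "(perp (Rad (e i)) (Rad (e j)) \<and> (\<forall>X\<in>tangential k.
      smile k (e j) X \<and> perp (Rad X) (Rad (e j)) \<longrightarrow> perp (Rad (e i)) (Rad X))) \<longleftrightarrow> Rad (e i) \<subseteq> e j"
      by simp
  qed
qed

lemma perp_Rad_definable_frown:
  assumes k: "odd k" "k + 3 \<le> dim (UNIV :: 'v set)"
  shows "env_definable (tangential k) (frown k) (\<lambda>e. perp (Rad (e i)) (Rad (e j)))"
proof -
  let ?n = "dim (UNIV :: 'v set)"
  have nk: "odd (?n - k)" "3 \<le> ?n - k" "?n - k + 1 \<le> ?n"
    using even_dim_UNIV k odd_pos[OF k(1)] by (simp_all del: dim_UNIV)
  have kn: "k + 1 \<le> ?n" "k \<le> ?n" using k by simp_all
  have "env_definable (tangential k) (frown k) (\<lambda>e. perp (Rad ((orth \<circ> e) i)) (Rad ((orth \<circ> e) j)))"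
    using frown_iff_smile_orth[OF k(1) kn(1)]
    by (intro env_definable_iso[OF bij_betw_orth_tangential[OF kn(2)] _ perp_Rad_definable_smile[OF nk]]) auto
  then show ?thesis
  proof (rule env_definable_cong)
    fix e :: "nat \<Rightarrow> 'v set" assume "range e \<subseteq> tangential k"
    then have "e i \<in> tangential k" "e j \<in> tangential k" by auto
    then show "perp (Rad ((orth \<circ> e) i)) (Rad ((orth \<circ> e) j)) \<longleftrightarrow> perp (Rad (e i)) (Rad (e j))"
      by (simp add: orth_tangential(2))
  qed
qed

text \<open>Passing to complements only transfers \<open>Rad X \<subseteq> orth W\<close>. Inclusion
  in \<open>W\<close> itself is recovered as orthogonality to every point of \<open>orth W\<close>,
  each such point being a radical.\<close>

lemma Rad_subset_definable_frown:
  assumes k: "odd k" "k + 3 \<le> dim (UNIV :: 'v set)"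
  shows "env_definable (tangential k) (frown k) (\<lambda>e. Rad (e i) \<subseteq> e j)"
proof -
  let ?n = "dim (UNIV :: 'v set)"
  have nk: "odd (?n - k)" "3 \<le> ?n - k" "?n - k + 1 \<le> ?n"
    using even_dim_UNIV k odd_pos[OF k(1)] by (simp_all del: dim_UNIV)
  have kn: "k + 1 \<le> ?n" "k \<le> ?n" using k by simp_all
  obtain a where a: "a \<notin> {i, j}" using fresh_variable[of "{i, j}"] by auto
  have Rad_subset_orth: "env_definable (tangential k) (frown k) (\<lambda>e. Rad (e a) \<subseteq> orth (e j))"
  proof -
    have "env_definable (tangential k) (frown k) (\<lambda>e. Rad ((orth \<circ> e) a) \<subseteq> (orth \<circ> e) j)"
      using frown_iff_smile_orth[OF k(1) kn(1)]
      by (intro env_definable_iso[OF bij_betw_orth_tangential[OF kn(2)] _ Rad_subset_definable_smile[OF nk]]) auto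
    then show ?thesis
    proof (rule env_definable_cong)
      fix e :: "nat \<Rightarrow> 'v set" assume "range e \<subseteq> tangential k"
      then have "e a \<in> tangential k" by auto
      then show "Rad ((orth \<circ> e) a) \<subseteq> (orth \<circ> e) j \<longleftrightarrow> Rad (e a) \<subseteq> orth (e j)"
        by (simp add: orth_tangential(2))
    qed
  qed
  have "env_definable (tangential k) (frown k) (\<lambda>e. \<forall>X\<in>tangential k.
      Rad X \<subseteq> orth (e j) \<longrightarrow> perp (Rad X) (Rad (e i)))"
    by (rule env_definable_ball[where i = a],
        intro env_definable_imp Rad_subset_orth perp_Rad_definable_frown[OF k]) (use a in simp_all)
  then show ?thesis
  proof (rule env_definable_cong)
    fix e :: "nat \<Rightarrow> 'v set" assume "range e \<subseteq> tangential k"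
    then have t: "e i \<in> tangential k" "e j \<in> tangential k" by auto
    show "(\<forall>X\<in>tangential k. Rad X \<subseteq> orth (e j) \<longrightarrow> perp (Rad X) (Rad (e i))) \<longleftrightarrow> Rad (e i) \<subseteq> e j"
    proof
      assume *: "\<forall>X\<in>tangential k. Rad X \<subseteq> orth (e j) \<longrightarrow> perp (Rad X) (Rad (e i))"
      have "orth (e j) \<subseteq> orth (Rad (e i))"
      proof
        fix v assume v: "v \<in> orth (e j)"
        show "v \<in> orth (Rad (e i))"
        proof (cases "v = 0")
          case False
          then have "span {v} \<in> points" by (auto simp: points_iff)
          then obtain X where X: "X \<in> tangential k" "Rad X = span {v}" using point_eq_Rad[OF k(1) kn(1)] by blast
          moreover have "span {v} \<subseteq> orth (e j)" using v by (intro span_minimal) auto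
          ultimately have "span {v} \<subseteq> orth (Rad (e i))" using * unfolding perp_iff by metis
          then show ?thesis by (auto intro: span_base)
        qed (simp add: subspace_0)
      qed
      then show "Rad (e i) \<subseteq> e j" using orth_subset_iff t tangentialD(1) by auto
    next
      assume "Rad (e i) \<subseteq> e j"
      then show "\<forall>X\<in>tangential k. Rad X \<subseteq> orth (e j) \<longrightarrow> perp (Rad X) (Rad (e i))"
        using orth_antimono[of "Rad (e i)" "e j"] by (auto simp: perp_iff)
    qed
  qed
qed

text \<open>Pairs encode both sorts: equal radicals give a point, different radicals a line.\<close>

definition join_Rad :: "'v set \<Rightarrow> 'v set \<Rightarrow> 'v set" where
  "join_Rad U W = span (Rad U \<union> Rad W)"

lemma join_Rad_same: "subspace U \<Longrightarrow> join_Rad U U = Rad U"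
  by (simp add: join_Rad_def span_of_subspace)

lemma join_Rad_cases:
  assumes U: "U \<in> tangential k" and W: "W \<in> tangential k"
  shows "join_Rad U W \<in> points \<longleftrightarrow> Rad U = Rad W" "join_Rad U W \<in> lines \<longleftrightarrow> Rad U \<noteq> Rad W"
proof -
  obtain p where p: "p \<noteq> 0" "Rad U = span {p}" using tangentialE[OF U] by blast
  obtain q where q: "q \<noteq> 0" "Rad W = span {q}" using tangentialE[OF W] by blast
  have j: "join_Rad U W = span {p, q}"
  proof -
    have "span ({p} \<union> {q}) = span (span {p} \<union> span {q})" unfolding span_Un by (simp add: span_span)
    then show ?thesis by (simp add: join_Rad_def p q insert_commute)
  qed
  have "p \<in> span {q} \<longleftrightarrow> Rad U = Rad W" using p q span_singleton_eqI[of p q] span_base[of p "{p}"] by auto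
  then have "dim (join_Rad U W) = (if Rad U = Rad W then 1 else 2)"
    using q unfolding j by (simp add: dim_insert)
  then show "join_Rad U W \<in> points \<longleftrightarrow> Rad U = Rad W" "join_Rad U W \<in> lines \<longleftrightarrow> Rad U \<noteq> Rad W"
    by (auto simp: points_def lines_def j)
qed

lemma line_eq_join_Rad:
  assumes k: "odd k" "k + 1 \<le> dim (UNIV :: 'v set)" and L: "L \<in> lines"
  obtains U W where "U \<in> tangential k" "W \<in> tangential k" "L = join_Rad U W" "Rad U \<noteq> Rad W"
proof -
  obtain p q where pq: "p \<noteq> 0" "q \<noteq> 0" "span {p} \<noteq> span {q}" "L = span {p, q}"
    using L dim_span_2_E unfolding lines_def by blast
  then have "span {p} \<in> points" "span {q} \<in> points" by (auto simp: points_iff)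
  then obtain U W where UW: "U \<in> tangential k" "Rad U = span {p}" "W \<in> tangential k" "Rad W = span {q}"
    using point_eq_Rad[OF k] by metis
  moreover have "span ({p} \<union> {q}) = span (span {p} \<union> span {q})" unfolding span_Un by (simp add: span_span)
  ultimately show thesis using pq that by (simp add: join_Rad_def insert_commute)
qed

text \<open>Inclusion is reversed by \<open>orth\<close>, and the inclusion of the complements can
  be tested on points, all of which are radicals.\<close>

lemma join_Rad_subset_iff:
  assumes k: "odd k" "k + 1 \<le> dim (UNIV :: 'v set)"
  shows "join_Rad U W \<subseteq> join_Rad U' W' \<longleftrightarrow>
    (\<forall>Z\<in>tangential k. perp (Rad Z) (Rad U') \<and> perp (Rad Z) (Rad W') \<longrightarrow>
       perp (Rad Z) (Rad U) \<and> perp (Rad Z) (Rad W))"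
proof -
  have perp: "perp P (Rad X) \<and> perp P (Rad Y) \<longleftrightarrow> P \<subseteq> orth (join_Rad X Y)" for P X Y
    by (auto simp: perp_iff join_Rad_def orth_Un)
  have sub: "subspace (join_Rad X Y)" for X Y by (simp add: join_Rad_def)
  show ?thesis
    unfolding perp orth_subset_iff[OF sub sub, symmetric]
  proof (intro iffI ballI impI subsetI)
    fix v assume *: "\<forall>Z\<in>tangential k. Rad Z \<subseteq> orth (join_Rad U' W') \<longrightarrow> Rad Z \<subseteq> orth (join_Rad U W)"
      and v: "v \<in> orth (join_Rad U' W')"
    show "v \<in> orth (join_Rad U W)"
    proof (cases "v = 0")
      case False
      then have "span {v} \<in> points" by (auto simp: points_iff)
      then obtain Z where Z: "Z \<in> tangential k" "Rad Z = span {v}" using point_eq_Rad[OF k] by blast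
      moreover have "span {v} \<subseteq> orth (join_Rad U' W')" using v by (intro span_minimal) auto
      ultimately have "span {v} \<subseteq> orth (join_Rad U W)" using * by metis
      then show ?thesis by (auto intro: span_base)
    qed (simp add: subspace_0)
  qed blast
qed

section \<open>Conclusions common to both adjacency relations\<close>

context
  fixes k :: nat and E :: "'v set \<Rightarrow> 'v set \<Rightarrow> bool"
  assumes k: "odd k" "k + 1 \<le> dim (UNIV :: 'v set)"
    and perp_Rad_definable: "\<And>i j. env_definable (tangential k) E (\<lambda>e. perp (Rad (e i)) (Rad (e j)))"
    and Rad_subset_definable: "\<And>i j. env_definable (tangential k) E (\<lambda>e. Rad (e i) \<subseteq> e j)"
begin

lemma join_Rad_subset_definable:
  "env_definable (tangential k) E (\<lambda>e. join_Rad (e i) (e j) \<subseteq> join_Rad (e l) (e m))"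
proof -
  obtain a where a: "a \<notin> {i, j, l, m}" using fresh_variable[of "{i, j, l, m}"] by auto
  show ?thesis
    unfolding join_Rad_subset_iff[OF k]
    by (rule env_definable_ball[where i = a],
        intro env_definable_intros perp_Rad_definable) (use a in simp_all)
qed

lemma Rad_eq_definable: "env_definable (tangential k) E (\<lambda>e. Rad (e i) = Rad (e j))"
proof -
  have "env_definable (tangential k) E (\<lambda>e. join_Rad (e i) (e i) \<subseteq> join_Rad (e j) (e j) \<and>
      join_Rad (e j) (e j) \<subseteq> join_Rad (e i) (e i))"
    by (intro env_definable_conj join_Rad_subset_definable)
  then show ?thesis
  proof (rule env_definable_cong)
    fix e :: "nat \<Rightarrow> 'v set" assume "range e \<subseteq> tangential k"
    then have "subspace (e i)" "subspace (e j)" using tangentialD(1) by blast+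
    then show "join_Rad (e i) (e i) \<subseteq> join_Rad (e j) (e j) \<and> join_Rad (e j) (e j) \<subseteq> join_Rad (e i) (e i) \<longleftrightarrow>
        Rad (e i) = Rad (e j)"
      by (auto simp: join_Rad_same)
  qed
qed

lemma projective_space_definable: "projective_space_definable_from (tangential k) E"
  unfolding projective_space_definable_from_def fo_interpretable_def
proof (intro exI conjI ballI)
  \<comment> \<open>All pairs are codes, so a valid equation defines the domain; different pairs may
    encode the same element.\<close>
  let ?D = "{[U, W] | U W. U \<in> tangential k \<and> W \<in> tangential k}"
  let ?h = "\<lambda>s. join_Rad (s ! 0) (s ! 1)"
  have upt: "[0..<2 + 2] = [0, 1, 2, 3 :: nat]" "[0..<2] = [0, 1 :: nat]" "[0..<2 + 1] = [0, 1, 2 :: nat]"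
    by (simp_all add: upt_rec)
  have mem: "e i \<in> tangential k" if "range e \<subseteq> tangential k" for e :: "nat \<Rightarrow> 'v set" and i using that by auto
  show "?D \<subseteq> {s. length s = 2 \<and> set s \<subseteq> tangential k}" by auto
  show "?h ` ?D = points \<union> lines"
  proof
    show "?h ` ?D \<subseteq> points \<union> lines" using join_Rad_cases by auto
    show "points \<union> lines \<subseteq> ?h ` ?D"
    proof
      fix X assume "X \<in> points \<union> lines"
      then have "\<exists>U\<in>tangential k. \<exists>W\<in>tangential k. X = join_Rad U W"
      proof
        assume "X \<in> points"
        then obtain U where "U \<in> tangential k" "Rad U = X" using point_eq_Rad[OF k] by blast
        then show ?thesis using join_Rad_same tangentialD(1) by metis
      next
        assume "X \<in> lines"
        then show ?thesis using line_eq_join_Rad[OF k] by metis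
      qed
      then obtain U W where "U \<in> tangential k" "W \<in> tangential k" "X = join_Rad U W" by blast
      then show "X \<in> ?h ` ?D" by (intro image_eqI[of _ _ "[U, W]"]) auto
    qed
  qed
  show "fo_definable (tangential k) E 2 ?D"
    unfolding fo_definable_iff_env_definable
    by (rule env_definable_cong[OF env_definable_eq[of _ _ 0 0]]) (simp add: upt mem)
  show "fo_definable (tangential k) E (2 + 1)
     {s @ [a] |s a. s \<in> ?D \<and> a \<in> tangential k \<and> ?h s \<subseteq> a}"
    unfolding fo_definable_iff_env_definable
  proof (rule env_definable_cong)
    show "env_definable (tangential k) E (\<lambda>e. Rad (e 0) \<subseteq> e 2 \<and> Rad (e 1) \<subseteq> e 2)"
      by (intro env_definable_conj Rad_subset_definable)
    fix e :: "nat \<Rightarrow> 'v set" assume e: "range e \<subseteq> tangential k"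
    have "join_Rad (e 0) (e 1) \<subseteq> e 2 \<longleftrightarrow> Rad (e 0) \<union> Rad (e 1) \<subseteq> e 2"
      unfolding join_Rad_def
      using span_minimal[OF _ tangentialD(1)[OF mem[OF e, of 2]], of "Rad (e 0) \<union> Rad (e 1)"]
        span_superset[of "Rad (e 0) \<union> Rad (e 1)"] by (meson subset_trans)
    then show "Rad (e 0) \<subseteq> e 2 \<and> Rad (e 1) \<subseteq> e 2 \<longleftrightarrow>
        map e [0..<2 + 1] \<in> {s @ [a] |s a. s \<in> ?D \<and> a \<in> tangential k \<and> ?h s \<subseteq> a}"
      unfolding upt using mem[OF e] by auto
  qed
  fix R :: "'v set \<Rightarrow> 'v set \<Rightarrow> bool"
  assume R: "R \<in> insert (=) {\<lambda>X Y. X \<in> points \<and> Y \<in> lines \<and> X \<subseteq> Y, \<lambda>X Y. X \<in> points \<and> Y \<in> points \<and> perp X Y}"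
  have "env_definable (tangential k) E (\<lambda>e. R (join_Rad (e 0) (e 1)) (join_Rad (e 2) (e 3)))"
  proof -
    from R consider "R = (=)" | "R = (\<lambda>X Y. X \<in> points \<and> Y \<in> lines \<and> X \<subseteq> Y)"
      | "R = (\<lambda>X Y. X \<in> points \<and> Y \<in> points \<and> perp X Y)" by blast
    then show ?thesis
    proof cases
      case 1
      show ?thesis unfolding 1 set_eq_subset
        by (intro env_definable_conj join_Rad_subset_definable)
    next
      case 2
      have "env_definable (tangential k) E (\<lambda>e. Rad (e 0) = Rad (e 1) \<and> \<not> Rad (e 2) = Rad (e 3) \<and>
          join_Rad (e 0) (e 1) \<subseteq> join_Rad (e 2) (e 3))"
        by (intro env_definable_conj env_definable_neg join_Rad_subset_definable Rad_eq_definable)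
      then show ?thesis unfolding 2
        by (rule env_definable_cong) (simp add: join_Rad_cases[OF mem mem])
    next
      case 3
      have "env_definable (tangential k) E (\<lambda>e. Rad (e 0) = Rad (e 1) \<and> Rad (e 2) = Rad (e 3) \<and>
          perp (Rad (e 0)) (Rad (e 2)))"
        by (intro env_definable_conj perp_Rad_definable Rad_eq_definable)
      then show ?thesis unfolding 3
      proof (rule env_definable_cong)
        fix e :: "nat \<Rightarrow> 'v set" assume e: "range e \<subseteq> tangential k"
        have "join_Rad (e i) (e j) = Rad (e i)" if "Rad (e i) = Rad (e j)" for i j
          using that join_Rad_same[OF tangentialD(1)[OF mem[OF e, of i]]] by (simp add: join_Rad_def)
        then show "Rad (e 0) = Rad (e 1) \<and> Rad (e 2) = Rad (e 3) \<and> perp (Rad (e 0)) (Rad (e 2)) \<longleftrightarrow>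
            join_Rad (e 0) (e 1) \<in> points \<and> join_Rad (e 2) (e 3) \<in> points \<and>
            perp (join_Rad (e 0) (e 1)) (join_Rad (e 2) (e 3))"
          unfolding join_Rad_cases[OF mem[OF e] mem[OF e]] by metis
      qed
    qed
  qed
  then show "fo_definable (tangential k) E (2 + 2) {s @ t |s t. s \<in> ?D \<and> t \<in> ?D \<and> R (?h s) (?h t)}"
    unfolding fo_definable_iff_env_definable
  proof (rule env_definable_cong)
    fix e :: "nat \<Rightarrow> 'v set" assume e: "range e \<subseteq> tangential k"
    have map: "map e [0..<2 + 2] = [e 0, e 1] @ [e 2, e 3]"
      by (simp only: upt list.map append.simps)
    show "R (join_Rad (e 0) (e 1)) (join_Rad (e 2) (e 3)) \<longleftrightarrow>
      map e [0..<2 + 2] \<in> {s @ t |s t. s \<in> ?D \<and> t \<in> ?D \<and> R (?h s) (?h t)}" (is "?l \<longleftrightarrow> ?r")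
    proof
      assume ?l
      moreover have "[e 0, e 1] \<in> ?D" "[e 2, e 3] \<in> ?D" using mem[OF e] by blast+
      ultimately have "[e 0, e 1] \<in> ?D \<and> [e 2, e 3] \<in> ?D \<and> R (?h [e 0, e 1]) (?h [e 2, e 3])" by simp
      then show ?r unfolding map by blast
    next
      assume ?r
      then show ?l unfolding map by auto
    qed
  qed
qed

lemma determined_by_automorphism_of_definable:
  assumes f: "bij_betw f (tangential k) (tangential k)" and pres: "preserves (tangential k) E f"
  shows "determined_by_automorphism (tangential k) f"
proof -
  let ?T = "tangential k"
  note aut = env_definable_automorphism[OF _ f pres]
  have fT: "f U \<in> ?T" if "U \<in> ?T" for U using that bij_betwE[OF f] by blast
  have surj: "\<exists>V\<in>?T. U = f V" if "U \<in> ?T" for U using that f by (auto simp: bij_betw_def)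
  have perp_f: "perp (Rad (f U)) (Rad (f W)) \<longleftrightarrow> perp (Rad U) (Rad W)" if "U \<in> ?T" "W \<in> ?T" for U W
    \<comment> \<open>Every variable other than 0 is sent to \<open>W\<close>, which keeps the range
      of the assignment inside the domain.\<close>
    using aut[OF perp_Rad_definable[of 0 1], of "\<lambda>n. if n = 0 then U else W"] that by auto
  have eq_f: "Rad (f U) = Rad (f W) \<longleftrightarrow> Rad U = Rad W" if "U \<in> ?T" "W \<in> ?T" for U W
    using aut[OF Rad_eq_definable[of 0 1], of "\<lambda>n. if n = 0 then U else W"] that by auto
  have sub_f: "Rad (f U) \<subseteq> f W \<longleftrightarrow> Rad U \<subseteq> W" if "U \<in> ?T" "W \<in> ?T" for U W
    using aut[OF Rad_subset_definable[of 0 1], of "\<lambda>n. if n = 0 then U else W"] that by auto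
  have join_f: "Rad (f Z) \<subseteq> join_Rad (f U) (f W) \<longleftrightarrow> Rad Z \<subseteq> join_Rad U W"
    if "Z \<in> ?T" "U \<in> ?T" "W \<in> ?T" for Z U W
    using aut[OF join_Rad_subset_definable[of 0 0 1 2], of "\<lambda>n. if n = 0 then Z else if n = 1 then U else W"] that
      join_Rad_same[OF tangentialD(1)[OF that(1)]] join_Rad_same[OF tangentialD(1)[OF fT[OF that(1)]]] by auto
  \<comment> \<open>The choice of the representative \<open>U\<close> does not matter, since
    \<open>f\<close> preserves equality of radicals.\<close>
  define F where "F P = Rad (f (SOME U. U \<in> ?T \<and> Rad U = P))" for P
  have F: "F (Rad U) = Rad (f U)" if "U \<in> ?T" for U
  proof -
    have "(SOME V. V \<in> ?T \<and> Rad V = Rad U) \<in> ?T \<and> Rad (SOME V. V \<in> ?T \<and> Rad V = Rad U) = Rad U"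
      by (rule someI[of _ U]) (use that in simp)
    then show ?thesis unfolding F_def using eq_f that by blast
  qed
  have pts: "P \<in> points \<longleftrightarrow> (\<exists>U\<in>?T. P = Rad U)" for P
    using point_eq_Rad[OF k] Rad_tangential_point by metis
  \<comment> \<open>This one fact serves three times: for surjectivity with
    \<open>X = Y = UNIV\<close>, for lines, and for the members of the domain.\<close>
  have F_sub: "F ` {P \<in> points. P \<subseteq> X} = {P \<in> points. P \<subseteq> Y}"
    if "\<And>U. U \<in> ?T \<Longrightarrow> Rad (f U) \<subseteq> Y \<longleftrightarrow> Rad U \<subseteq> X" for X Y
  proof (intro equalityI subsetI)
    fix P assume "P \<in> F ` {P \<in> points. P \<subseteq> X}"
    then obtain U where U: "U \<in> ?T" "Rad U \<subseteq> X" "P = F (Rad U)" using pts by auto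
    then show "P \<in> {P \<in> points. P \<subseteq> Y}"
      using F[OF U(1)] that[OF U(1)] Rad_tangential_point[OF fT[OF U(1)]] by simp
  next
    fix P assume P: "P \<in> {P \<in> points. P \<subseteq> Y}"
    then obtain V where "V \<in> ?T" "P = Rad V" using pts by blast
    then obtain U where U: "U \<in> ?T" "P = Rad (f U)" using surj by blast
    then have "Rad U \<in> {P \<in> points. P \<subseteq> X}" "P = F (Rad U)"
      using P that[OF U(1)] F[OF U(1)] Rad_tangential_point[OF U(1)] by simp_all
    then show "P \<in> F ` {P \<in> points. P \<subseteq> X}" by (rule rev_image_eqI)
  qed
  have bij: "bij_betw F points points"
    unfolding bij_betw_def
  proof
    show "inj_on F points" using pts F eq_f by (auto simp: inj_on_def)
    show "F ` points = points" using F_sub[of UNIV UNIV] by simp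
  qed
  have line: "F ` points_on (join_Rad U W) = points_on (join_Rad (f U) (f W))" if "U \<in> ?T" "W \<in> ?T" for U W
    unfolding points_on_def using that by (intro F_sub) (simp add: join_f)
  have "(\<lambda>L. F ` points_on L) ` lines = points_on ` lines"
  proof (intro equalityI subsetI)
    fix S assume "S \<in> (\<lambda>L. F ` points_on L) ` lines"
    then obtain L where L: "L \<in> lines" "S = F ` points_on L" by blast
    then obtain U W where UW: "U \<in> ?T" "W \<in> ?T" "L = join_Rad U W" "Rad U \<noteq> Rad W"
      using line_eq_join_Rad[OF k] by blast
    then have "join_Rad (f U) (f W) \<in> lines" using join_Rad_cases(2)[OF fT fT] eq_f by auto
    then show "S \<in> points_on ` lines" using L UW line by auto
  next
    fix S assume "S \<in> points_on ` lines"
    then obtain L where L: "L \<in> lines" "S = points_on L" by blast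
    then obtain U' W' where UW': "U' \<in> ?T" "W' \<in> ?T" "L = join_Rad U' W'" "Rad U' \<noteq> Rad W'"
      using line_eq_join_Rad[OF k] by blast
    then obtain U W where UW: "U \<in> ?T" "W \<in> ?T" "U' = f U" "W' = f W" using surj by metis
    have "Rad U \<noteq> Rad W" using eq_f[OF UW(1,2)] UW(3,4) UW'(4) by simp
    then have "join_Rad U W \<in> lines" using join_Rad_cases(2)[OF UW(1,2)] by simp
    moreover have "S = F ` points_on (join_Rad U W)" using L(2) UW(3,4) UW'(3) line[OF UW(1,2)] by simp
    ultimately show "S \<in> (\<lambda>L. F ` points_on L) ` lines" by blast
  qed
  then have "collineation F" using bij by (simp add: collineation_def)
  moreover have "perp (F P) (F Q) \<longleftrightarrow> perp P Q" if "P \<in> points" "Q \<in> points" for P Q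
    using that F perp_f by (auto simp: pts)
  moreover have "points_on (f U) = F ` points_on U" if "U \<in> ?T" for U
    unfolding points_on_def using that by (intro F_sub[symmetric]) (simp add: sub_f)
  ultimately show ?thesis
    unfolding determined_by_automorphism_def perp_automorphism_def by blast
qed

end

end

theorem theorem1p7:
  fixes scale :: "'k::field \<Rightarrow> 'v::ab_group_add \<Rightarrow> 'v"
    and Basis :: "'v set"
    and \<xi> :: "'v \<Rightarrow> 'v \<Rightarrow> 'k"
    and n k :: nat
  assumes "symplectic_space scale Basis \<xi>"
    and "n = vector_space.dim scale (UNIV :: 'v set)"
    and "odd k" and "1 \<le> k" and "k \<le> n - 1"
  shows "(k \<noteq> 1 \<longrightarrow>
            symplectic_space.projective_space_definable_from scale \<xi>
              (symplectic_space.tangential scale \<xi> k) (symplectic_space.smile scale \<xi> k)) \<and>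
         (k \<noteq> n - 1 \<longrightarrow>
            symplectic_space.projective_space_definable_from scale \<xi>
              (symplectic_space.tangential scale \<xi> k) (symplectic_space.frown scale \<xi> k)) \<and>
         (\<forall>f. bij_betw f (symplectic_space.tangential scale \<xi> k)
                        (symplectic_space.tangential scale \<xi> k) \<and>
              (k \<noteq> 1 \<and> preserves (symplectic_space.tangential scale \<xi> k)
                            (symplectic_space.smile scale \<xi> k) f \<or>
               k \<noteq> n - 1 \<and> preserves (symplectic_space.tangential scale \<xi> k)
                            (symplectic_space.frown scale \<xi> k) f) \<longrightarrow>
              symplectic_space.determined_by_automorphism scale \<xi>
                (symplectic_space.tangential scale \<xi> k) f)"
proof -
  interpret symplectic_space scale Basis \<xi> by fact
  have n: "n = dim (UNIV :: 'v set)" by fact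
  have kn: "k + 1 \<le> dim (UNIV :: 'v set)" using assms(4,5) n by linarith
  \<comment> \<open>As \<open>n\<close> is even and \<open>k\<close> odd, excluding
    \<open>k = n - 1\<close> leaves \<open>k \<le> n - 3\<close>, and excluding \<open>k = 1\<close>
    leaves \<open>k \<ge> 3\<close>.\<close>
  have "even n" using even_dim_UNIV n by simp
  then have kn3: "k + 3 \<le> dim (UNIV :: 'v set)" if "k \<noteq> n - 1" using that assms(3-5) n by presburger
  have k3: "3 \<le> k" if "k \<noteq> 1" using that assms(3) by presburger
  note smile = perp_Rad_definable_smile[OF assms(3) k3 kn] Rad_subset_definable_smile[OF assms(3) k3 kn]
  note frown = perp_Rad_definable_frown[OF assms(3) kn3] Rad_subset_definable_frown[OF assms(3) kn3]
  show ?thesis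
    using projective_space_definable[OF assms(3) kn smile] projective_space_definable[OF assms(3) kn frown]
      determined_by_automorphism_of_definable[OF assms(3) kn smile]
      determined_by_automorphism_of_definable[OF assms(3) kn frown] by blast
qed

end
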